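(* Let $(\mathcal{T},\mathcal{E},(x_K)_{K\in\mathcal{T}})$ be an admissible mesh of $\Omega$, let $0=t_0<t_1<\dots<t_{N_T}=T$ with $\Delta t_n=t_n-t_{n-1}$, let $U^0=(u_1^0,\dots,u_N^0)\in L^\infty(\Omega;\mathcal{A})$ satisfy $\int_\Omega u_i^0\,dx>0$ for all $i\in\{1,\dots,N\}$, and let $\boldsymbol{U}^0=(u^0_{i,K})_{i,K}$ be defined by $u_{i,K}^0=\frac{1}{m_K}\int_K u_i^0(x)\,dx$. Then, proceeding successively for $n=1,\dots,N_T$ (with $\boldsymbol{U}^{n-1}$ being $\boldsymbol{U}^0$ if $n=1$, or a positive solution in $\mathcal{A}^{\mathcal{T}}$ obtained at the previous step if $n\ge 2$), the nonlinear system of the scheme at step $n$ has a solution $\boldsymbol{U}^n=(u_{i,K}^n)_{i,K}\in\mathcal{A}^{\mathcal{T}}$ that is positive, i.e. $u_{i,K}^n>0$ for all $i\in\{1,\dots,N\}$ and $K\in\mathcal{T}$. Moreover, such a solution $(\boldsymbol{U}^n)_{1\le n\le N_T}$ satisfies $E_{\mathcal{T}}(\boldsymbol{U}^n)\le E_{\mathcal{T}}(\boldsymbol{U}^{n-1})$ for all $n\in\{1,\dots,N_T\}$, and $\sum_{K\in\mathcal{T}}m_K u_{i,K}^n=\int_\Omega u_i^0\,dx$ for all $i\in\{1,\dots,N\}$ and $n\in\{0,\dots,N_T\}$.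
   Context: Data. $\Omega\subset\mathbb{R}^d$ is a nonempty connected bounded open set, $T>0$, $N$ is the number of species, and $A=(a_{i,j})_{1\le i,j\le N}$ is a real symmetric matrix with $a_{i,j}\ge 0$. $\mathcal{A}=\{(u_1,\dots,u_N)\in\mathbb{R}_+^N : \sum_{i=1}^N u_i=1\}$ with $\mathbb{R}_+=[0,\infty)$; $U^0\in L^\infty(\Omega;\mathcal{A})$ means $U^0$ is measurable with values in $\mathcal{A}$. Admissible mesh of $\Omega$. A triplet $(\mathcal{T},\mathcal{E},(x_K)_{K\in\mathcal{T}})$ with $\mathcal{T},\mathcal{E}$ finite such that: (i) each control volume (cell) $K\in\mathcal{T}$ is a non-empty, open, polyhedral, convex subset of $\Omega$, distinct cells are disjoint, and $\bigcup_{K}\overline K=\overline\Omega$; (ii) each face $\sigma\in\mathcal{E}$ is closed, contained in a hyperplane of $\mathbb{R}^d$, with $(d-1)$-dimensional Hausdorff measure $m_\sigma>0$; distinct faces intersect in a set of zero $(d-1)$-dimensional Hausdorff measure; for each $K$ there is $\mathcal{E}_K\subset\mathcal{E}$ with $\partial K=\bigcup_{\sigma\in\mathcal{E}_K}\sigma$, and $\bigcup_K\mathcal{E}_K=\mathcal{E}$; for distinct $K,L$, $\overline K\cap\overline L$ is either a single face of $\mathcal{E}$, denoted $K|L$, or has zero $(d-1)$-dimensional Hausdorff measure; (iii) $x_K\in K$, and if $K,L$ share a face $K|L$ then $x_L-x_K$ is orthogonal to $K|L$; (iv) for $\sigma\in\mathcal{E}_K$ with $\sigma\subset\partial\Omega$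 there is $x_\sigma\in\sigma$ with $x_\sigma-x_K$ orthogonal to $\sigma$. $m_K$ is the Lebesgue measure of $K$; $\mathcal{E}_{\rm int}$ is the set of faces of the form $K|L$, $\mathcal{E}_{\rm ext}$ the set of faces contained in $\partial\Omega$. $d_\sigma=|x_K-x_L|$ if $\sigma=K|L\in\mathcal{E}_{\rm int}$, $d_\sigma=|x_K-x_\sigma|$ if $\sigma\in\mathcal{E}_{\rm ext}\cap\mathcal{E}_K$, and $\tau_\sigma=m_\sigma/d_\sigma$. Discrete notation. $\boldsymbol{U}=(u_{i,K})_{1\le i\le N,K\in\mathcal{T}}\in(\mathbb{R}^{\mathcal{T}})^N$, $\boldsymbol{u}_i=(u_{i,K})_{K}$; $\boldsymbol{U}\in\mathcal{A}^{\mathcal{T}}$ means $(u_{1,K},\dots,u_{N,K})\in\mathcal{A}$ for all $K$. For $\boldsymbol{c}\in\mathbb{R}^{\mathcal{T}}$ and $\sigma\in\mathcal{E}_K$: $c_{K\sigma}=c_L$ if $\sigma=K|L\in\mathcal{E}_{\rm int}$, $c_{K\sigma}=c_K$ if $\sigma\in\mathcal{E}_{\rm ext}$, and $D_{K\sigma}\boldsymbol{c}=c_{K\sigma}-c_K$. Scheme. Fix a parameter $a^\star$ with $a^\star>0$ and $a^\star\ge\min_{(i,j)}a_{i,j}$. Given $\boldsymbol{U}^{n-1}$, the system at step $n$ for the unknown $\boldsymbol{U}^n$ is, for all $K\in\mathcal{T}$ and $i\in\{1,\dots,N\}$, $$m_K\frac{u_{i,K}^n-u_{i,K}^{n-1}}{\Delta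 t_n}+\sum_{\sigma\in\mathcal{E}_K}F_{i,K\sigma}^n=0,$$ $$F_{i,K\sigma}^n=-a^\star\tau_\sigma D_{K\sigma}\boldsymbol{u}_i^n-\tau_\sigma\sum_{j=1}^N(a_{i,j}-a^\star)\left(u_{j,\sigma}^nD_{K\sigma}\boldsymbol{u}_i^n-u_{i,\sigma}^nD_{K\sigma}\boldsymbol{u}_j^n\right),$$ where $u_{j,\sigma}^n=0$ if $\min(u_{j,K}^n,u_{j,K\sigma}^n)\le 0$; $u_{j,\sigma}^n=u_{j,K}^n$ if $u_{j,K}^n=u_{j,K\sigma}^n>0$; and $u_{j,\sigma}^n=\frac{u_{j,K}^n-u_{j,K\sigma}^n}{\ln u_{j,K}^n-\ln u_{j,K\sigma}^n}$ otherwise. Discrete entropy. $E_{\mathcal{T}}(\boldsymbol{U})=\sum_{K\in\mathcal{T}}\sum_{i=1}^N m_Ku_{i,K}\ln u_{i,K}$ for $\boldsymbol{U}\in\mathcal{A}^{\mathcal{T}}$, with $0\ln 0=0$. *)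

theory Defs
  imports "HOL-Analysis.Analysis"
begin

section \<open>Hausdorff measure\<close>

text \<open>
  The usual normalisation: in dimension \<open>k\<close> a nonempty set of diameter \<open>r\<close> has weight
  \<open>\<omega>\<^sub>k (r / 2)\<^sup>k\<close>, with \<open>\<omega>\<^sub>k\<close> the volume of the unit ball.
  For \<open>k = 0\<close> every nonempty set has weight 1 (as \<open>0 ^ 0 = 1\<close>), which gives the
  counting measure; the empty set needs a case of its own.
\<close>

definition hausdorff_weight :: "nat \<Rightarrow> 'a::metric_space set \<Rightarrow> ennreal" where
  "hausdorff_weight k S =
     (if S = {} then 0 else ennreal (unit_ball_vol (real k) * (diameter S / 2) ^ k))"

text \<open>The boundedness condition is needed because \<^const>\<open>diameter\<close> is a junk value on unbounded sets.\<close>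

definition hausdorff_pre :: "nat \<Rightarrow> real \<Rightarrow> 'a::metric_space set \<Rightarrow> ennreal" where
  "hausdorff_pre k \<delta> S =
     (INF C \<in> {C :: nat \<Rightarrow> 'a set. S \<subseteq> (\<Union>n. C n) \<and> (\<forall>n. bounded (C n) \<and> diameter (C n) \<le> \<delta>)}.
        \<Sum>n. hausdorff_weight k (C n))"

definition hausdorff :: "nat \<Rightarrow> 'a::metric_space set \<Rightarrow> ennreal" where
  "hausdorff k S = (SUP \<delta> \<in> {0<..}. hausdorff_pre k \<delta> S)"

abbreviation surface :: "'a::euclidean_space set \<Rightarrow> ennreal" where
  "surface S \<equiv> hausdorff (DIM('a) - 1) S"

section \<open>Admissible meshes\<close>

text \<open>
  A cell is identified with the open set it occupies, a face with its closed set of points.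
  Besides the triplet \<open>(\<T>, \<E>, (x\<^sub>K))\<close>, the record carries the sets
  \<open>\<E>\<^sub>K\<close> and the points \<open>x\<^sub>\<sigma>\<close> whose existence admissibility asserts.
\<close>

record 'a mesh =
  cells :: "'a set set"
  faces :: "'a set set"
  center :: "'a set \<Rightarrow> 'a"
  cell_faces :: "'a set \<Rightarrow> 'a set set"
  face_point :: "'a set \<Rightarrow> 'a"

definition face_measure :: "'a::euclidean_space set \<Rightarrow> real" where
  "face_measure \<sigma> = enn2real (surface \<sigma>)"

definition orthogonal_to_set :: "'a::euclidean_space \<Rightarrow> 'a set \<Rightarrow> bool" where
  "orthogonal_to_set v S \<longleftrightarrow> (\<forall>p\<in>S. \<forall>q\<in>S. orthogonal v (p - q))"

text \<open>\<open>shared_face M K L \<sigma>\<close> says that \<open>\<sigma>\<close> is the interior face \<open>K|L\<close>.\<close>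

definition shared_face ::
  "'a::euclidean_space mesh \<Rightarrow> 'a set \<Rightarrow> 'a set \<Rightarrow> 'a set \<Rightarrow> bool" where
  "shared_face M K L \<sigma> \<longleftrightarrow>
     K \<in> cells M \<and> L \<in> cells M \<and> K \<noteq> L \<and> \<sigma> \<in> faces M \<and> \<sigma> = closure K \<inter> closure L"

text \<open>
  \<^const>\<open>polyhedron\<close> is a finite intersection of closed half-spaces, so an open convex set is
  polyhedral if its closure is a \<^const>\<open>polyhedron\<close>. A face, being a subset of the
  bounded set \<open>\<partial>K\<close> in a hyperplane, has finite measure, so that positivity of the real
  number \<^const>\<open>face_measure\<close> is positivity of the Hausdorff measure.
\<close>

definition admissible_mesh :: "'a::euclidean_space set \<Rightarrow> 'a mesh \<Rightarrow> bool" where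
  "admissible_mesh \<Omega> M \<longleftrightarrow>
     finite (cells M) \<and> finite (faces M) \<and>
     (\<forall>K\<in>cells M. K \<noteq> {} \<and> open K \<and> convex K \<and> polyhedron (closure K) \<and> K \<subseteq> \<Omega>) \<and>
     (\<forall>K\<in>cells M. \<forall>L\<in>cells M. K \<noteq> L \<longrightarrow> K \<inter> L = {}) \<and>
     (\<Union>K\<in>cells M. closure K) = closure \<Omega> \<and>
     (\<forall>\<sigma>\<in>faces M. closed \<sigma> \<and> (\<exists>a b. a \<noteq> 0 \<and> \<sigma> \<subseteq> {x. a \<bullet> x = b}) \<and> face_measure \<sigma> > 0) \<and>
     (\<forall>\<sigma>\<in>faces M. \<forall>\<sigma>'\<in>faces M. \<sigma> \<noteq> \<sigma>' \<longrightarrow> surface (\<sigma> \<inter> \<sigma>') = 0) \<and>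
     (\<forall>K\<in>cells M. cell_faces M K \<subseteq> faces M \<and> frontier K = \<Union>(cell_faces M K)) \<and>
     (\<Union>K\<in>cells M. cell_faces M K) = faces M \<and>
     (\<forall>K\<in>cells M. \<forall>L\<in>cells M. K \<noteq> L \<longrightarrow>
        closure K \<inter> closure L \<in> faces M \<or> surface (closure K \<inter> closure L) = 0) \<and>
     (\<forall>K\<in>cells M. center M K \<in> K) \<and>
     (\<forall>K L \<sigma>. shared_face M K L \<sigma> \<longrightarrow> orthogonal_to_set (center M L - center M K) \<sigma>) \<and>
     (\<forall>K\<in>cells M. \<forall>\<sigma>\<in>cell_faces M K. \<sigma> \<subseteq> frontier \<Omega> \<longrightarrow>
        face_point M \<sigma> \<in> \<sigma> \<and> orthogonal_to_set (face_point M \<sigma> - center M K) \<sigma>)"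

text \<open>
  \<open>d\<^sub>\<sigma>\<close> and \<open>\<tau>\<^sub>\<sigma>\<close>, seen from a cell \<open>K\<close> with \<open>\<sigma> \<in> \<E>\<^sub>K\<close>; for \<open>\<sigma> = K|L\<close> the
  values seen from \<open>K\<close> and from \<open>L\<close> agree. Every case distinction below tests for an
  interior face first: this settles the degenerate faces \<open>K|L\<close> contained in \<open>\<partial>\<Omega>\<close> (\<open>\<Omega>\<close> may lie
  on both sides of its boundary), and all faces that are not of the form \<open>K|L\<close> are no-flux faces.
\<close>

definition neighbour :: "'a::euclidean_space mesh \<Rightarrow> 'a set \<Rightarrow> 'a set \<Rightarrow> 'a set" where
  "neighbour M K \<sigma> = (THE L. shared_face M K L \<sigma>)"

definition face_dist :: "'a::euclidean_space mesh \<Rightarrow> 'a set \<Rightarrow> 'a set \<Rightarrow> real" where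
  "face_dist M K \<sigma> =
     (if \<exists>L. shared_face M K L \<sigma> then norm (center M K - center M (neighbour M K \<sigma>))
      else norm (center M K - face_point M \<sigma>))"

definition transmissibility :: "'a::euclidean_space mesh \<Rightarrow> 'a set \<Rightarrow> 'a set \<Rightarrow> real" where
  "transmissibility M K \<sigma> = face_measure \<sigma> / face_dist M K \<sigma>"

definition mirror_value ::
  "'a::euclidean_space mesh \<Rightarrow> ('a set \<Rightarrow> real) \<Rightarrow> 'a set \<Rightarrow> 'a set \<Rightarrow> real" where
  "mirror_value M c K \<sigma> = (if \<exists>L. shared_face M K L \<sigma> then c (neighbour M K \<sigma>) else c K)"

definition face_diff ::
  "'a::euclidean_space mesh \<Rightarrow> ('a set \<Rightarrow> real) \<Rightarrow> 'a set \<Rightarrow> 'a set \<Rightarrow> real" where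
  "face_diff M c K \<sigma> = mirror_value M c K \<sigma> - c K"

section \<open>The scheme\<close>

definition simplex_set :: "(real ^ 'n::finite) set" where
  "simplex_set = {u. (\<forall>i. 0 \<le> u $ i) \<and> (\<Sum>i\<in>UNIV. u $ i) = 1}"

definition log_mean :: "real \<Rightarrow> real \<Rightarrow> real" where
  "log_mean a b =
     (if min a b \<le> 0 then 0 else if a = b then a else (a - b) / (ln a - ln b))"

text \<open>
  A discrete state \<open>U\<close> has components \<open>u\<^sub>i\<^sub>,\<^sub>K\<close> = \<open>U K $ i\<close>; only its values on the cells matter.
\<close>

definition component :: "('a set \<Rightarrow> real ^ 'n::finite) \<Rightarrow> 'n \<Rightarrow> 'a set \<Rightarrow> real" where
  "component U i K = U K $ i"

definition face_value ::
  "'a::euclidean_space mesh \<Rightarrow> ('a set \<Rightarrow> real) \<Rightarrow> 'a set \<Rightarrow> 'a set \<Rightarrow> real" where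
  "face_value M c K \<sigma> = log_mean (c K) (mirror_value M c K \<sigma>)"

definition flux ::
  "'a::euclidean_space mesh \<Rightarrow> real ^ 'n ^ 'n \<Rightarrow> real \<Rightarrow> ('a set \<Rightarrow> real ^ 'n::finite)
     \<Rightarrow> 'n \<Rightarrow> 'a set \<Rightarrow> 'a set \<Rightarrow> real" where
  "flux M A astar U i K \<sigma> =
     - astar * transmissibility M K \<sigma> * face_diff M (component U i) K \<sigma>
     - transmissibility M K \<sigma> *
         (\<Sum>j\<in>UNIV. (A $ i $ j - astar) *
            (face_value M (component U j) K \<sigma> * face_diff M (component U i) K \<sigma>
             - face_value M (component U i) K \<sigma> * face_diff M (component U j) K \<sigma>))"

definition solves_scheme ::
  "'a::euclidean_space mesh \<Rightarrow> real ^ 'n ^ 'n \<Rightarrow> real \<Rightarrow> real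
     \<Rightarrow> ('a set \<Rightarrow> real ^ 'n::finite) \<Rightarrow> ('a set \<Rightarrow> real ^ 'n) \<Rightarrow> bool" where
  "solves_scheme M A astar dt Uprev U \<longleftrightarrow>
     (\<forall>K\<in>cells M. \<forall>i.
        measure lebesgue K * ((U K $ i - Uprev K $ i) / dt)
        + (\<Sum>\<sigma>\<in>cell_faces M K. flux M A astar U i K \<sigma>) = 0)"

definition positive_solution ::
  "'a::euclidean_space mesh \<Rightarrow> real ^ 'n ^ 'n \<Rightarrow> real \<Rightarrow> real
     \<Rightarrow> ('a set \<Rightarrow> real ^ 'n::finite) \<Rightarrow> ('a set \<Rightarrow> real ^ 'n) \<Rightarrow> bool" where
  "positive_solution M A astar dt Uprev U \<longleftrightarrow>
     solves_scheme M A astar dt Uprev U \<and>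
     (\<forall>K\<in>cells M. U K \<in> simplex_set) \<and> (\<forall>K\<in>cells M. \<forall>i. U K $ i > 0)"

definition cell_average ::
  "('a::euclidean_space \<Rightarrow> real ^ 'n::finite) \<Rightarrow> 'a set \<Rightarrow> real ^ 'n" where
  "cell_average u K = (\<chi> i. (LINT x|lebesgue_on K. u x $ i) / measure lebesgue K)"

text \<open>The convention \<open>0 ln 0 = 0\<close> holds automatically.\<close>

definition discrete_entropy ::
  "'a::euclidean_space mesh \<Rightarrow> ('a set \<Rightarrow> real ^ 'n::finite) \<Rightarrow> real" where
  "discrete_entropy M U =
     (\<Sum>K\<in>cells M. \<Sum>i\<in>UNIV. measure lebesgue K * (U K $ i) * ln (U K $ i))"

end

theory Submission
  imports Defs
begin

text \<open>
  On the simplex the flux between two cells is, with \<open>\<ell>\<^sub>i\<close> the logarithmic means and \<open>D\<^sub>i\<close> the jumps,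
  \<open>- \<tau> (\<Sum>\<^sub>j a\<^sub>i\<^sub>j (\<ell>\<^sub>j D\<^sub>i - \<ell>\<^sub>i D\<^sub>j) + a\<^sup>* max 0 (1 - \<Sum>\<^sub>j \<ell>\<^sub>j) D\<^sub>i)\<close>. In this form the scheme is posed on
  the cube \<open>0 \<le> u\<^sub>i\<^sub>,\<^sub>K \<le> 1\<close>, and Brouwer's theorem yields \<open>u\<close> at which every residual is \<open>\<le> 0\<close> where
  \<open>u\<^sub>i\<^sub>,\<^sub>K > 0\<close> and \<open>\<ge> 0\<close> where \<open>u\<^sub>i\<^sub>,\<^sub>K < 1\<close>. Since \<open>\<ell>\<^sub>i = 0\<close> where \<open>u\<^sub>i\<^sub>,\<^sub>K = 0\<close>, the residual is \<open>\<le> 0\<close> there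
  as well, hence everywhere. The sum of the residuals over the species is the residual of a linear
  diffusion equation for \<open>s = \<Sum>\<^sub>i u\<^sub>i\<close>; evaluating it at a maximum and at a minimum of \<open>s\<close> gives \<open>s = 1\<close>.
  Then the residuals in each cell are nonpositive with sum zero, so they vanish.

  A zero of \<open>u\<^sub>i\<close> propagates to the neighbouring cells, and the graph of cells is connected, so a zero
  would force the mass of species \<open>i\<close>, which is conserved, to vanish. Entropy decay follows from
  convexity, as \<open>D\<^sub>i = \<ell>\<^sub>i D(ln u\<^sub>i)\<close> makes the dissipation a sum of squares.

  The graph is connected because a closed set of vanishing surface measure cannot separate the
  connected open set \<open>\<Omega>\<close>. A face has at most two adjacent cells because it has positive surface measure
  and thus affine dimension \<open>d - 1\<close>, and disjoint convex cells cannot lie on the same side of it.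
\<close>

section \<open>A complementarity problem on the cube\<close>

text \<open>Bolzano-Weierstrass for one index after the other: each new index refines the
  subsequence found so far, and finiteness of \<open>I\<close> lets this end.\<close>

lemma finite_family_convergent_subsequence:
  fixes X :: "nat \<Rightarrow> 'k \<Rightarrow> real"
  assumes "finite I" and "\<And>n k. k \<in> I \<Longrightarrow> X n k \<in> {0..1}"
  shows "\<exists>r x. strict_mono r \<and> (\<forall>k\<in>I. x k \<in> {0..1} \<and> (\<lambda>n. X (r n) k) \<longlonglongrightarrow> x k)"
  using assms
proof (induction I rule: finite_induct)
  case empty
  have "strict_mono (id :: nat \<Rightarrow> nat)"
    by (simp add: strict_mono_def)
  then show ?case by auto
next
  case (insert a I)
  then obtain r x where r: "strict_mono r"
    and x: "\<forall>k\<in>I. x k \<in> {0..1} \<and> (\<lambda>n. X (r n) k) \<longlonglongrightarrow> x k"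
    by fastforce
  have "\<forall>n. X (r n) a \<in> {0..1}"
    using insert.prems by auto
  then obtain l s where l: "l \<in> {0..1}" and s: "strict_mono s"
    and lim: "((\<lambda>n. X (r n) a) \<circ> s) \<longlonglongrightarrow> l"
    using compact_Icc[of "0::real" 1] unfolding compact_def by meson
  have "(\<lambda>n. X (r (s n)) k) \<longlonglongrightarrow> x k" if "k \<in> I" for k
    using x that LIMSEQ_subseq_LIMSEQ[OF _ s, of "\<lambda>n. X (r n) k"] by (auto simp: o_def)
  then have "\<forall>k\<in>insert a I. (x(a := l)) k \<in> {0..1} \<and>
      (\<lambda>n. X ((r \<circ> s) n) k) \<longlonglongrightarrow> (x(a := l)) k"
    using lim l x insert.hyps by (auto simp: o_def)
  then show ?case
    using strict_mono_o[OF r s] by blast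
qed

text \<open>Brouwer's theorem in the form of a complementarity problem on a cube. The dimension is
  the cardinality of a set rather than of a type, hence the direct appeal to Kuhn's
  combinatorial lemma.\<close>

lemma box_complementarity:
  fixes G :: "('k \<Rightarrow> real) \<Rightarrow> 'k \<Rightarrow> real"
  assumes fin: "finite I"
    and cont: "\<And>X x k. \<lbrakk>\<And>n j. j \<in> I \<Longrightarrow> X n j \<in> {0..1};
        \<And>j. j \<in> I \<Longrightarrow> (\<lambda>n. X n j) \<longlonglongrightarrow> x j; k \<in> I\<rbrakk> \<Longrightarrow> (\<lambda>n. G (X n) k) \<longlonglongrightarrow> G x k"
  obtains x where "\<And>k. k \<in> I \<Longrightarrow> x k \<in> {0..1}"
    and "\<And>k. k \<in> I \<Longrightarrow> x k = 0 \<or> G x k \<le> 0"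
    and "\<And>k. k \<in> I \<Longrightarrow> x k = 1 \<or> G x k \<ge> 0"
proof -
  define n where "n = card I"
  obtain b where b: "bij_betw b {0..<n} I"
    using ex_bij_betw_nat_finite[OF fin] n_def by blast
  define g where "g = the_inv_into {0..<n} b"
  have gb: "b (g k) = k" "g k < n" if "k \<in> I" for k
    using f_the_inv_into_f_bij_betw[OF b] bij_betwE[OF bij_betw_the_inv_into[OF b]] that
    by (auto simp: g_def)
  define sc :: "nat \<Rightarrow> (nat \<Rightarrow> nat) \<Rightarrow> 'k \<Rightarrow> real"
    where "sc = (\<lambda>p y k. real (y (g k)) / real p)"
  \<comment> \<open>Kuhn's labels record the sign of \<open>G\<close>. The values forced at
    \<open>0\<close> and \<open>p\<close> are what Kuhn's lemma demands, and they are why each sign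
    condition in the conclusion has an exception at one end of the interval.\<close>
  define lab :: "nat \<Rightarrow> (nat \<Rightarrow> nat) \<Rightarrow> nat \<Rightarrow> nat"
    where "lab = (\<lambda>p y i. if y i = 0 then 0 else if y i = p then 1
                   else if G (sc p y) (b i) > 0 then 1 else 0)"
  define near :: "(nat \<Rightarrow> nat) \<Rightarrow> (nat \<Rightarrow> nat) \<Rightarrow> bool"
    where "near = (\<lambda>q r. \<forall>j<n. q j \<le> r j \<and> r j \<le> q j + 1)"
  have "\<exists>q. (\<forall>i<n. q i < Suc m) \<and>
      (\<forall>i<n. \<exists>r s. near q r \<and> near q s \<and> lab (Suc m) r i \<noteq> lab (Suc m) s i)" for m
  proof -
    have "\<forall>x. (\<forall>i<n. x i \<le> Suc m) \<longrightarrow> (\<forall>i<n. lab (Suc m) x i = 0 \<or> lab (Suc m) x i = 1)"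
      "\<forall>x. (\<forall>i<n. x i \<le> Suc m) \<longrightarrow> (\<forall>i<n. x i = 0 \<longrightarrow> lab (Suc m) x i = 0)"
      "\<forall>x. (\<forall>i<n. x i \<le> Suc m) \<longrightarrow> (\<forall>i<n. x i = Suc m \<longrightarrow> lab (Suc m) x i = 1)"
      by (auto simp: lab_def)
    then obtain q where "\<forall>i<n. q i < Suc m" and "\<forall>i<n. \<exists>r s. (\<forall>j<n. q j \<le> r j \<and> r j \<le> q j + 1) \<and>
        (\<forall>j<n. q j \<le> s j \<and> s j \<le> q j + 1) \<and> lab (Suc m) r i \<noteq> lab (Suc m) s i"
      by (rule kuhn_lemma[OF zero_less_Suc])
    then show ?thesis
      unfolding near_def by (intro exI[of _ q] conjI)
  qed
  then obtain q where qrs: "\<forall>m. (\<forall>i<n. q m i < Suc m) \<and>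
      (\<forall>i<n. \<exists>r s. near (q m) r \<and> near (q m) s \<and> lab (Suc m) r i \<noteq> lab (Suc m) s i)"
    by (rule exE[OF choice[OF allI]])
  have q: "q m i < Suc m" if "i < n" for m i
    using qrs that by blast
  \<comment> \<open>The two vertices carry different labels out of 0 and 1, so each label occurs at
    one of them.\<close>
  have ex: "\<exists>r. near (q m) r \<and> lab (Suc m) r i = c" if i: "i < n" and c: "c = 0 \<or> c = 1" for m i c
  proof -
    obtain r s where *: "near (q m) r" "near (q m) s" "lab (Suc m) r i \<noteq> lab (Suc m) s i"
      using qrs i by blast
    have "lab (Suc m) r i = c \<or> lab (Suc m) s i = c"
      using *(3) c by (auto simp: lab_def split: if_splits)
    then show ?thesis using * by blast
  qed
  define R where "R = (\<lambda>m i c. SOME r. near (q m) r \<and> lab (Suc m) r i = c)"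
  have nearR: "near (q m) (R m i c)" and labR: "lab (Suc m) (R m i c) i = c"
    if "i < n" "c = 0 \<or> c = 1" for m i c
    using someI_ex[OF ex[OF that]] unfolding R_def by blast+
  have R: "q m j \<le> R m i c j \<and> R m i c j \<le> q m j + 1"
    if "i < n" "c = 0 \<or> c = 1" "j < n" for m i c j
    using nearR[OF that(1,2)] that(3) by (simp add: near_def)
  define Q where "Q = (\<lambda>m. sc (Suc m) (q m))"
  have Q01: "Q m k \<in> {0..1}" if "k \<in> I" for m k
    using q[OF gb(2)[OF that], of m] by (simp add: Q_def sc_def divide_simps)
  obtain r x where r: "strict_mono r" and x01: "\<And>k. k \<in> I \<Longrightarrow> x k \<in> {0..1}"
    and limQ: "\<And>k. k \<in> I \<Longrightarrow> (\<lambda>m. Q (r m) k) \<longlonglongrightarrow> x k"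
    using finite_family_convergent_subsequence[OF fin, of Q] Q01 by metis
  define X where "X = (\<lambda>i c m. sc (Suc (r m)) (R (r m) i c))"
  have X01: "X i c m j \<in> {0..1}" if "i < n" "c = 0 \<or> c = 1" "j \<in> I" for i c m j
    using R[OF that(1,2) gb(2)[OF that(3)], of "r m"] q[OF gb(2)[OF that(3)], of "r m"]
    by (simp add: X_def sc_def divide_simps)
  \<comment> \<open>All vertices of a small cube lie within one grid step of its corner, so the
    vertices chosen for either label share the limit \<open>x\<close> of the corners.\<close>
  have limX: "(\<lambda>m. X i c m j) \<longlonglongrightarrow> x j" if "i < n" "c = 0 \<or> c = 1" "j \<in> I" for i c j
  proof -
    have bd: "\<bar>X i c m j - Q (r m) j\<bar> \<le> 1 / real (Suc m)" for m
    proof -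
      have "\<bar>real (R (r m) i c (g j)) - real (q (r m) (g j))\<bar> \<le> 1"
        using R[OF that(1,2) gb(2)[OF that(3)], of "r m"] by auto
      then have "\<bar>X i c m j - Q (r m) j\<bar> \<le> 1 / real (Suc (r m))"
        by (simp add: X_def Q_def sc_def diff_divide_distrib[symmetric] divide_right_mono
            del: of_nat_Suc)
      also have "\<dots> \<le> 1 / real (Suc m)"
        using seq_suble[OF r, of m] by (simp add: field_simps)
      finally show ?thesis .
    qed
    have "(\<lambda>m. X i c m j - Q (r m) j) \<longlonglongrightarrow> 0"
      by (rule Lim_null_comparison[OF _ lim_1_over_n[THEN LIMSEQ_Suc]]) (use bd in simp)
    from tendsto_add[OF this limQ[OF that(3)]] show ?thesis by simp
  qed
  have min_max_eq_0: "a = 0 \<or> b \<le> 0" if "min a (max b 0) = 0" for a b :: real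
    using that by linarith
  show thesis
  proof (rule that[of x])
    fix k assume k: "k \<in> I"
    have i: "g k < n" "b (g k) = k" using gb k by auto
    have G: "(\<lambda>m. G (X (g k) c m) k) \<longlonglongrightarrow> G x k" if "c = 0 \<or> c = 1" for c
      using X01[OF i(1) that] limX[OF i(1) that] k by (rule cont)
    show "x k \<in> {0..1}" using x01 k .
    \<comment> \<open>The alternative "the coordinate is 0 or \<open>G\<close> is \<le> 0" is
      written as one equation between continuous expressions, so that it survives the limit.\<close>
    have e0: "min (X (g k) 0 m k) (max (G (X (g k) 0 m) k) 0) = 0" for m
    proof -
      have "R (r m) (g k) 0 (g k) = 0 \<or> \<not> G (sc (Suc (r m)) (R (r m) (g k) 0)) k > 0"
        using labR[OF i(1), of 0 "r m"] unfolding lab_def i(2) by (simp split: if_splits)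
      then have "X (g k) 0 m k = 0 \<or> G (X (g k) 0 m) k \<le> 0"
        unfolding X_def not_less by (elim disj_forward) (simp add: sc_def)
      moreover have "0 \<le> X (g k) 0 m k" using X01[OF i(1) _ k, of 0 m] by simp
      ultimately show ?thesis by linarith
    qed
    have l0: "(\<lambda>m. min (X (g k) 0 m k) (max (G (X (g k) 0 m) k) 0))
        \<longlonglongrightarrow> min (x k) (max (G x k) 0)"
      using limX[OF i(1) _ k] G by (intro tendsto_min tendsto_max tendsto_const) simp_all
    have "min (x k) (max (G x k) 0) = 0"
      by (rule LIMSEQ_unique[OF l0[unfolded e0] tendsto_const])
    then show "x k = 0 \<or> G x k \<le> 0" by (rule min_max_eq_0)
    have e1: "min (1 - X (g k) 1 m k) (max (- G (X (g k) 1 m) k) 0) = 0" for m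
    proof -
      have "R (r m) (g k) 1 (g k) = Suc (r m) \<or> G (sc (Suc (r m)) (R (r m) (g k) 1)) k > 0"
        using labR[OF i(1) disjI2[OF refl], of "r m"] unfolding lab_def i(2)
        by (metis zero_neq_one)
      then have "X (g k) 1 m k = 1 \<or> G (X (g k) 1 m) k \<ge> 0"
        unfolding X_def by (elim disj_forward) (simp only: sc_def, simp, rule less_imp_le)
      moreover have "X (g k) 1 m k \<le> 1" using X01[OF i(1) _ k, of 1 m] by simp
      ultimately show ?thesis by linarith
    qed
    have l1: "(\<lambda>m. min (1 - X (g k) 1 m k) (max (- G (X (g k) 1 m) k) 0))
        \<longlonglongrightarrow> min (1 - x k) (max (- G x k) 0)"
      using limX[OF i(1) _ k] G
      by (intro tendsto_min tendsto_max tendsto_minus tendsto_diff tendsto_const) simp_all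
    have "min (1 - x k) (max (- G x k) 0) = 0"
      by (rule LIMSEQ_unique[OF l1[unfolded e1] tendsto_const])
    then have "1 - x k = 0 \<or> - G x k \<le> 0" by (rule min_max_eq_0)
    then show "x k = 1 \<or> G x k \<ge> 0" by linarith
  qed
qed

section \<open>The logarithmic mean\<close>

lemma log_mean_commute: "log_mean a b = log_mean b a"
  unfolding log_mean_def using minus_divide_divide[of "a - b" "ln a - ln b"]
  by (simp add: min.commute)

lemma log_mean_self: "a \<ge> 0 \<Longrightarrow> log_mean a a = a"
  by (simp add: log_mean_def)

lemma log_mean_zero [simp]: "log_mean 0 b = 0" "log_mean a 0 = 0"
  by (simp_all add: log_mean_def)

lemma log_mean_mult_ln_diff:
  "a > 0 \<Longrightarrow> b > 0 \<Longrightarrow> log_mean a b * (ln b - ln a) = b - a"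
  by (auto simp: log_mean_def field_simps)

text \<open>The estimate behind the upper bound of the logarithmic mean by the arithmetic mean. Both
  sides vanish at \<open>t = 1\<close>, and their difference has the derivative
  \<open>(t - 1)\<^sup>2 / (t * (t + 1)\<^sup>2)\<close>.\<close>

lemma ln_ge_pade:
  fixes t :: real
  assumes "t \<ge> 1"
  shows "2 * (t - 1) / (t + 1) \<le> ln t"
proof -
  define h :: "real \<Rightarrow> real" where "h = (\<lambda>t. ln t - 2 * (t - 1) / (t + 1))"
  have "h 1 \<le> h t"
  proof (rule DERIV_nonneg_imp_nondecreasing[OF assms])
    fix x :: real assume x: "1 \<le> x" "x \<le> t"
    then have nz: "x \<noteq> 0" "x + 1 \<noteq> 0" by auto
    have "1 / x - (2 * (x + 1) - 2 * (x - 1)) / ((x + 1) * (x + 1)) = (x - 1)\<^sup>2 / (x * (x + 1)\<^sup>2)"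
      using nz by (simp add: divide_simps power2_eq_square) algebra
    moreover have "(h has_real_derivative
        1 / x - (2 * (x + 1) - 2 * (x - 1)) / ((x + 1) * (x + 1))) (at x)"
      unfolding h_def using x nz by (auto intro!: derivative_eq_intros)
    ultimately have "(h has_real_derivative (x - 1)\<^sup>2 / (x * (x + 1)\<^sup>2)) (at x)"
      by simp
    then show "\<exists>y. (h has_real_derivative y) (at x) \<and> 0 \<le> y"
      using x by (intro exI[of _ "(x - 1)\<^sup>2 / (x * (x + 1)\<^sup>2)"]) auto
  qed
  then show ?thesis by (simp add: h_def)
qed

text \<open>Lower bound: \<open>ln x \<le> x - 1\<close> at \<open>x = a / b\<close>. Upper bound:
  \<open>ln_ge_pade\<close> at the same point.\<close>

lemma log_mean_bounds_less:
  assumes "0 < b" "b < a"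
  shows "b \<le> log_mean a b" "log_mean a b \<le> (a + b) / 2"
proof -
  have L: "log_mean a b = (a - b) / (ln a - ln b)"
    using assms by (simp add: log_mean_def)
  have ln: "ln a - ln b = ln (a / b)" using assms by (simp add: ln_div)
  have pos: "ln a - ln b > 0" using assms by simp
  have "ln (a / b) \<le> a / b - 1" using assms by (intro ln_le_minus_one) simp
  then have "b * (ln a - ln b) \<le> a - b"
    unfolding ln using assms by (simp add: field_simps)
  then show "b \<le> log_mean a b" using pos by (simp add: L pos_le_divide_eq)
  have "2 * (a / b - 1) / (a / b + 1) \<le> ln (a / b)"
    using assms by (intro ln_ge_pade) simp
  also have "2 * (a / b - 1) / (a / b + 1) = 2 * (a - b) / (a + b)"
    using assms by (simp add: divide_simps)
  finally have "a - b \<le> (a + b) / 2 * (ln a - ln b)"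
    unfolding ln using assms by (simp add: field_simps)
  then show "log_mean a b \<le> (a + b) / 2" using pos by (simp add: L pos_divide_le_eq)
qed

lemma log_mean_ge_min: "0 \<le> a \<Longrightarrow> 0 \<le> b \<Longrightarrow> min a b \<le> log_mean a b"
  using log_mean_bounds_less[of a b] log_mean_bounds_less[of b a]
  by (cases a b rule: linorder_cases; cases "min a b = 0")
     (auto simp: log_mean_commute[of a b] log_mean_self min_def split: if_splits)

lemma log_mean_nonneg: "0 \<le> a \<Longrightarrow> 0 \<le> b \<Longrightarrow> 0 \<le> log_mean a b"
  using log_mean_ge_min[of a b] by linarith

lemma log_mean_le_arith_mean: "0 \<le> a \<Longrightarrow> 0 \<le> b \<Longrightarrow> log_mean a b \<le> (a + b) / 2"
  using log_mean_bounds_less[of a b] log_mean_bounds_less[of b a]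
  by (cases a b rule: linorder_cases; cases "min a b = 0")
     (auto simp: log_mean_commute[of a b] log_mean_self min_def split: if_splits)

text \<open>Where \<open>f x > 0\<close>, the mean times \<open>ln (g x) - ln (f x)\<close> equals
  \<open>g x - f x\<close>, which stays bounded while the logarithmic factor grows without bound.
  Where \<open>f x = 0\<close> the mean is 0 by definition.\<close>

lemma tendsto_log_mean_zero:
  fixes f g :: "'x \<Rightarrow> real"
  assumes f: "(f \<longlongrightarrow> 0) F" and g: "(g \<longlongrightarrow> b) F" and "b > 0"
    and nn: "\<And>x. 0 \<le> f x" "\<And>x. 0 \<le> g x"
  shows "((\<lambda>x. log_mean (f x) (g x)) \<longlongrightarrow> 0) F"
proof (rule tendstoI)
  fix e :: real assume e: "e > 0"
  \<comment> \<open>With \<open>ln (g x) - ln (f x) > M\<close> and \<open>g x - f x < 2 * b\<close>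
    the mean is below \<open>2 * b / M = e / 2\<close>.\<close>
  define M where "M = 4 * b / e"
  have M: "M > 0" using e \<open>b > 0\<close> by (simp add: M_def)
  have "\<forall>\<^sub>F x in F. f x < exp (- M) * (b / 2)"
    using f by (rule order_tendstoD) (use \<open>b > 0\<close> in simp)
  moreover have "\<forall>\<^sub>F x in F. b / 2 < g x"
    using g by (rule order_tendstoD) (use \<open>b > 0\<close> in simp)
  moreover have "\<forall>\<^sub>F x in F. g x < 2 * b"
    using g by (rule order_tendstoD) (use \<open>b > 0\<close> in simp)
  ultimately show "\<forall>\<^sub>F x in F. dist (log_mean (f x) (g x)) 0 < e"
  proof eventually_elim
    case (elim x)
    show ?case
    proof (cases "f x = 0")
      case True
      then show ?thesis using e by simp
    next
      case False
      then have fx: "f x > 0" using nn(1)[of x] by simp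
      have gx: "g x > 0" using elim \<open>b > 0\<close> by linarith
      have "ln (f x) < ln (exp (- M) * (b / 2))"
        using elim fx \<open>b > 0\<close> by (subst ln_less_cancel_iff) auto
      also have "\<dots> = - M + ln (b / 2)" using \<open>b > 0\<close> by (subst ln_mult) auto
      also have "ln (b / 2) < ln (g x)" using elim \<open>b > 0\<close> gx by (subst ln_less_cancel_iff) auto
      finally have M': "M < ln (g x) - ln (f x)" by simp
      then have "log_mean (f x) (g x) * M \<le> log_mean (f x) (g x) * (ln (g x) - ln (f x))"
        using log_mean_nonneg[OF nn] by (intro mult_left_mono) auto
      also have "\<dots> = g x - f x" using log_mean_mult_ln_diff[OF fx gx] .
      also have "\<dots> < 2 * b" using elim fx by linarith
      finally have "log_mean (f x) (g x) < e"
        using M e \<open>b > 0\<close> unfolding M_def by (simp add: field_simps)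
      then show ?thesis using log_mean_nonneg[OF nn, of x x] by simp
    qed
  qed
qed

text \<open>On the diagonal, the origin included, the mean is squeezed between the minimum and the
  arithmetic mean. On the axes away from the origin \<open>tendsto_log_mean_zero\<close> applies,
  and elsewhere the quotient formula is continuous.\<close>

lemma tendsto_log_mean:
  fixes f g :: "'x \<Rightarrow> real"
  assumes f: "(f \<longlongrightarrow> a) F" and g: "(g \<longlongrightarrow> b) F" and ab: "0 \<le> a" "0 \<le> b"
    and nn: "\<And>x. 0 \<le> f x" "\<And>x. 0 \<le> g x"
  shows "((\<lambda>x. log_mean (f x) (g x)) \<longlongrightarrow> log_mean a b) F"
proof -
  consider "a = b" | "a = 0" "b > 0" | "b = 0" "a > 0" | "a > 0" "b > 0" "a \<noteq> b"
    using ab by linarith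
  then show ?thesis
  proof cases
    case 1
    have "((\<lambda>x. min (f x) (g x)) \<longlongrightarrow> min a b) F" "((\<lambda>x. (f x + g x) / 2) \<longlongrightarrow> (a + b) / 2) F"
      by (intro tendsto_intros f g; simp)+
    then have "((\<lambda>x. min (f x) (g x)) \<longlongrightarrow> a) F" "((\<lambda>x. (f x + g x) / 2) \<longlongrightarrow> a) F"
      using 1 by simp_all
    then have "((\<lambda>x. log_mean (f x) (g x)) \<longlongrightarrow> a) F"
      by (rule tendsto_sandwich[rotated 2]) (use log_mean_ge_min log_mean_le_arith_mean nn in
          \<open>auto intro!: always_eventually simp del: le_divide_eq_numeral1\<close>)
    then show ?thesis using 1 ab by (simp add: log_mean_self)
  next
    case 2
    then show ?thesis using tendsto_log_mean_zero[OF _ g _ nn] f by simp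
  next
    case 3
    then show ?thesis using tendsto_log_mean_zero[OF _ f _ nn(2,1)] g
      by (simp add: log_mean_commute)
  next
    case 4
    have "((\<lambda>x. f x - g x) \<longlongrightarrow> a - b) F" by (intro tendsto_intros f g)
    then have ne: "\<forall>\<^sub>F x in F. f x - g x \<noteq> 0"
      by (rule tendsto_imp_eventually_ne) (use 4 in simp)
    have "((\<lambda>x. (f x - g x) / (ln (f x) - ln (g x))) \<longlongrightarrow> (a - b) / (ln a - ln b)) F"
      using 4 by (intro tendsto_intros f g) auto
    moreover have "\<forall>\<^sub>F x in F. (f x - g x) / (ln (f x) - ln (g x)) = log_mean (f x) (g x)"
      using order_tendstoD(1)[OF f 4(1)] order_tendstoD(1)[OF g 4(2)] ne
      by eventually_elim (auto simp: log_mean_def)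
    ultimately show ?thesis
      using 4 by (auto simp: log_mean_def elim: Lim_transform_eventually)
  qed
qed

section \<open>The scheme on a weighted graph\<close>

text \<open>The flux of the scheme divided by the transmissibility, between a cell in state
  \<open>x\<close> and a neighbour in state \<open>y\<close>.\<close>

definition pair_flux :: "real ^ 'n ^ 'n \<Rightarrow> real \<Rightarrow> real ^ 'n \<Rightarrow> real ^ 'n \<Rightarrow> 'n::finite \<Rightarrow> real" where
  "pair_flux A astar x y i =
     - astar * (y $ i - x $ i)
     - (\<Sum>j\<in>UNIV. (A $ i $ j - astar) *
          (log_mean (x $ j) (y $ j) * (y $ i - x $ i)
           - log_mean (x $ i) (y $ i) * (y $ j - x $ j)))"

text \<open>The truncation changes nothing on the simplex, where \<open>\<Sum>\<^sub>j D\<^sub>j = 0\<close> and the logarithmic means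
  sum up to at most 1, but keeps the diffusion coefficient nonnegative on the whole cube.\<close>

definition trunc_flux :: "real ^ 'n ^ 'n \<Rightarrow> real \<Rightarrow> real ^ 'n \<Rightarrow> real ^ 'n \<Rightarrow> 'n::finite \<Rightarrow> real" where
  "trunc_flux A astar x y i =
     - (\<Sum>j\<in>UNIV. A $ i $ j *
          (log_mean (x $ j) (y $ j) * (y $ i - x $ i)
           - log_mean (x $ i) (y $ i) * (y $ j - x $ j)))
     - astar * max 0 (1 - (\<Sum>j\<in>UNIV. log_mean (x $ j) (y $ j))) * (y $ i - x $ i)"

lemma pair_flux_swap: "pair_flux A astar y x i = - pair_flux A astar x y i"
proof -
  have "(\<Sum>j\<in>UNIV. (A $ i $ j - astar) *
          (log_mean (y $ j) (x $ j) * (x $ i - y $ i)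
           - log_mean (y $ i) (x $ i) * (x $ j - y $ j)))
    = (\<Sum>j\<in>UNIV. - ((A $ i $ j - astar) *
          (log_mean (x $ j) (y $ j) * (y $ i - x $ i)
           - log_mean (x $ i) (y $ i) * (y $ j - x $ j))))"
    by (intro sum.cong refl) (simp add: log_mean_commute[of "y $ k" "x $ k" for k] algebra_simps)
  then show ?thesis
    unfolding pair_flux_def by (simp only: sum_negf) (simp add: right_diff_distrib)
qed

lemma sum_log_mean_le_1:
  assumes "x \<in> simplex_set" "y \<in> simplex_set"
  shows "(\<Sum>j\<in>UNIV. log_mean (x $ j) (y $ j)) \<le> 1"
proof -
  have "(\<Sum>j\<in>UNIV. log_mean (x $ j) (y $ j)) \<le> (\<Sum>j\<in>UNIV. (x $ j + y $ j) / 2)"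
    using assms by (intro sum_mono log_mean_le_arith_mean) (auto simp: simplex_set_def)
  also have "\<dots> = 1"
    using assms by (simp add: simplex_set_def sum_divide_distrib[symmetric] sum.distrib)
  finally show ?thesis .
qed

text \<open>The jumps between two simplex states sum to zero, so the \<open>astar\<close> part of
  the cross-diffusion sum collapses to \<open>astar * S\<close> times the jump of species
  \<open>i\<close>, with \<open>S\<close> the sum of the logarithmic means. Together with the linear
  term this leaves the coefficient \<open>1 - S\<close>, nonnegative by
  \<open>sum_log_mean_le_1\<close>.\<close>

lemma pair_flux_eq_trunc_flux:
  assumes "x \<in> simplex_set" "y \<in> simplex_set"
  shows "pair_flux A astar x y i = trunc_flux A astar x y i"
proof -
  define X where "X j = log_mean (x $ j) (y $ j) * (y $ i - x $ i)
           - log_mean (x $ i) (y $ i) * (y $ j - x $ j)" for j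
  define S where "S = (\<Sum>j\<in>UNIV. log_mean (x $ j) (y $ j))"
  define T where "T = (\<Sum>j\<in>UNIV. A $ i $ j * X j)"
  have "(\<Sum>j\<in>UNIV. y $ j - x $ j) = 0"
    using assms by (simp add: simplex_set_def sum_subtractf)
  then have "(\<Sum>j\<in>UNIV. X j) = S * (y $ i - x $ i)"
    unfolding X_def S_def sum_subtractf[where g = "\<lambda>j. log_mean (x $ i) (y $ i) * _ j"]
    by (simp add: sum_distrib_left[symmetric] sum_distrib_right[symmetric])
  then have "(\<Sum>j\<in>UNIV. (A $ i $ j - astar) * X j) = T - astar * (S * (y $ i - x $ i))"
    by (simp only: left_diff_distrib sum_subtractf sum_distrib_left[symmetric] T_def)
  then have "pair_flux A astar x y i
      = - astar * (y $ i - x $ i) - (T - astar * (S * (y $ i - x $ i)))"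
    by (simp only: pair_flux_def X_def)
  moreover have "max 0 (1 - S) = 1 - S"
    using sum_log_mean_le_1[OF assms] by (simp add: S_def)
  then have "trunc_flux A astar x y i = - T - astar * (1 - S) * (y $ i - x $ i)"
    by (simp only: trunc_flux_def X_def T_def S_def)
  ultimately show ?thesis
    by (simp add: algebra_simps)
qed

lemma sum_antisym_eq_0:
  fixes f :: "'a \<Rightarrow> 'a \<Rightarrow> real"
  assumes "\<And>i j. i \<in> S \<Longrightarrow> j \<in> S \<Longrightarrow> f j i = - f i j"
  shows "(\<Sum>i\<in>S. \<Sum>j\<in>S. f i j) = 0"
proof -
  have "(\<Sum>i\<in>S. \<Sum>j\<in>S. f i j) = (\<Sum>j\<in>S. \<Sum>i\<in>S. - f j i)"
    by (subst sum.swap, intro sum.cong refl assms)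
  then show ?thesis by (simp add: sum_negf)
qed

lemma symmetric_matrix_nth:
  assumes "transpose A = A"
  shows "A $ i $ j = A $ j $ i"
  using arg_cong[OF assms, of "\<lambda>B. B $ j $ i"] by (simp add: transpose_def)

text \<open>By symmetry of \<open>A\<close> the cross-diffusion terms are antisymmetric in the two
  species and cancel. What remains is a diffusion flux for the total density, available before the
  states are known to lie in the simplex.\<close>

lemma sum_trunc_flux:
  assumes "transpose A = A"
  shows "(\<Sum>i\<in>UNIV. trunc_flux A astar x y i) =
     - astar * max 0 (1 - (\<Sum>j\<in>UNIV. log_mean (x $ j) (y $ j)))
       * ((\<Sum>i\<in>UNIV. y $ i) - (\<Sum>i\<in>UNIV. x $ i))"
proof -
  have "A $ i $ j = A $ j $ i" for i j
    using symmetric_matrix_nth[OF assms] .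
  then have "(\<Sum>i\<in>UNIV. \<Sum>j\<in>UNIV. A $ i $ j * (log_mean (x $ j) (y $ j) * (y $ i - x $ i)
           - log_mean (x $ i) (y $ i) * (y $ j - x $ j))) = 0"
    by (intro sum_antisym_eq_0) (simp add: algebra_simps)
  then show ?thesis
    by (simp add: trunc_flux_def sum_subtractf sum_negf sum_distrib_left[symmetric])
qed

text \<open>The logarithmic mean of an absent species is 0, so every term that remains is a
  nonnegative multiple of \<open>- y $ i\<close>.\<close>

lemma trunc_flux_nonpos:
  assumes "\<And>i j. A $ i $ j \<ge> 0" "astar > 0" "\<And>j. 0 \<le> x $ j" "\<And>j. 0 \<le> y $ j" "x $ i = 0"
  shows "trunc_flux A astar x y i \<le> 0"
proof -
  have "0 \<le> (\<Sum>j\<in>UNIV. A $ i $ j * (log_mean (x $ j) (y $ j) * y $ i))"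
    using assms by (intro sum_nonneg mult_nonneg_nonneg log_mean_nonneg) auto
  moreover have "0 \<le> astar * max 0 (1 - (\<Sum>j\<in>UNIV. log_mean (x $ j) (y $ j))) * y $ i"
    using assms(2,4) by (intro mult_nonneg_nonneg) auto
  ultimately show ?thesis
    by (simp add: trunc_flux_def \<open>x $ i = 0\<close> mult.assoc)
qed

text \<open>Species \<open>i\<close> has logarithmic mean 0 but a positive arithmetic mean, so the
  logarithmic means sum to less than 1 and the \<open>astar\<close> term is strictly active.\<close>

lemma pair_flux_neg:
  assumes A: "\<And>i j. A $ i $ j \<ge> 0" and "astar > 0"
    and xy: "x \<in> simplex_set" "y \<in> simplex_set" and i: "x $ i = 0" "y $ i > 0"
  shows "pair_flux A astar x y i < 0"
proof -
  have nn: "\<And>j. 0 \<le> x $ j" "\<And>j. 0 \<le> y $ j" using xy by (auto simp: simplex_set_def)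
  have "(\<Sum>j\<in>UNIV. log_mean (x $ j) (y $ j)) < (\<Sum>j\<in>UNIV. (x $ j + y $ j) / 2)"
    by (rule sum_strict_mono_ex1)
       (use log_mean_le_arith_mean nn i in \<open>auto intro!: exI[of _ i] simp del: le_divide_eq_numeral1\<close>)
  also have "\<dots> = 1"
    using xy by (simp add: simplex_set_def sum_divide_distrib[symmetric] sum.distrib)
  finally have "0 < astar * max 0 (1 - (\<Sum>j\<in>UNIV. log_mean (x $ j) (y $ j))) * y $ i"
    using i \<open>astar > 0\<close> by (intro mult_pos_pos) auto
  moreover have "0 \<le> (\<Sum>j\<in>UNIV. A $ i $ j * (log_mean (x $ j) (y $ j) * y $ i))"
    using A nn by (intro sum_nonneg mult_nonneg_nonneg log_mean_nonneg) auto
  ultimately show ?thesis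
    by (simp add: pair_flux_eq_trunc_flux[OF xy] trunc_flux_def i mult.assoc)
qed

text \<open>With \<open>D\<^sub>i = \<ell>\<^sub>i (ln y\<^sub>i - ln x\<^sub>i)\<close>, where \<open>\<ell>\<^sub>i\<close> is the logarithmic mean, the cross-diffusion
  part symmetrises to
  \<open>\<Sum>\<^sub>i\<^sub>j a\<^sub>i\<^sub>j \<ell>\<^sub>i \<ell>\<^sub>j (\<delta>\<^sub>i - \<delta>\<^sub>j)\<^sup>2 / 2\<close> with \<open>\<delta>\<^sub>i = ln y\<^sub>i - ln x\<^sub>i\<close>.\<close>

lemma pair_flux_dissipation:
  assumes sym: "transpose A = A" and A: "\<And>i j. A $ i $ j \<ge> 0" and "astar > 0"
    and xy: "x \<in> simplex_set" "y \<in> simplex_set" and pos: "\<And>i. x $ i > 0" "\<And>i. y $ i > 0"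
  shows "(\<Sum>i\<in>UNIV. pair_flux A astar x y i * (ln (y $ i) - ln (x $ i))) \<le> 0"
proof -
  define l where "l i = log_mean (x $ i) (y $ i)" for i
  define d where "d i = ln (y $ i) - ln (x $ i)" for i
  define c where "c = astar * max 0 (1 - (\<Sum>j\<in>UNIV. l j))"
  have D: "y $ i - x $ i = l i * d i" for i
    using log_mean_mult_ln_diff[OF pos] by (simp add: l_def d_def)
  have l: "l i \<ge> 0" for i unfolding l_def by (intro log_mean_nonneg less_imp_le pos)
  have As: "A $ i $ j = A $ j $ i" for i j
    using symmetric_matrix_nth[OF sym] .
  define Q where "Q = (\<Sum>i\<in>UNIV. \<Sum>j\<in>UNIV. A $ i $ j * (l i * l j) * (d i - d j) * d i)"
  have "Q = (\<Sum>j\<in>UNIV. \<Sum>i\<in>UNIV. A $ i $ j * (l i * l j) * (d i - d j) * d i)"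
    unfolding Q_def by (rule sum.swap)
  also have "\<dots> = (\<Sum>i\<in>UNIV. \<Sum>j\<in>UNIV. A $ i $ j * (l i * l j) * (d j - d i) * d j)"
    by (intro sum.cong refl) (subst As, simp add: ac_simps)
  finally have "Q + Q = (\<Sum>i\<in>UNIV. \<Sum>j\<in>UNIV. A $ i $ j * (l i * l j) * (d i - d j) * d i)
      + (\<Sum>i\<in>UNIV. \<Sum>j\<in>UNIV. A $ i $ j * (l i * l j) * (d j - d i) * d j)"
    by (rule arg_cong2[where f = "(+)", OF Q_def])
  also have "\<dots> = (\<Sum>i\<in>UNIV. \<Sum>j\<in>UNIV. A $ i $ j * (l i * l j) * (d i - d j)\<^sup>2)"
    unfolding sum.distrib[symmetric]
    by (intro sum.cong refl) (simp add: power2_eq_square algebra_simps)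
  also have "\<dots> \<ge> 0"
    by (intro sum_nonneg mult_nonneg_nonneg A l) simp
  finally have Q: "Q \<ge> 0" by simp
  have "pair_flux A astar x y i * d i =
     - (\<Sum>j\<in>UNIV. A $ i $ j * (l i * l j) * (d i - d j) * d i) - c * (l i * (d i)\<^sup>2)" for i
  proof -
    have "(\<Sum>j\<in>UNIV. A $ i $ j * (log_mean (x $ j) (y $ j) * (y $ i - x $ i)
           - log_mean (x $ i) (y $ i) * (y $ j - x $ j)))
        = (\<Sum>j\<in>UNIV. A $ i $ j * (l i * l j) * (d i - d j))"
      by (intro sum.cong refl) (simp only: D l_def[symmetric], simp add: algebra_simps)
    then have "trunc_flux A astar x y i =
       - (\<Sum>j\<in>UNIV. A $ i $ j * (l i * l j) * (d i - d j)) - c * (l i * d i)"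
      by (simp add: trunc_flux_def c_def D l_def[symmetric])
    then show ?thesis
      by (simp only: pair_flux_eq_trunc_flux[OF xy] left_diff_distrib[of _ _ "d i"]
          minus_mult_left[symmetric] sum_distrib_right power2_eq_square mult.assoc)
  qed
  then have "(\<Sum>i\<in>UNIV. pair_flux A astar x y i * d i) = - Q - c * (\<Sum>i\<in>UNIV. l i * (d i)\<^sup>2)"
    by (simp add: Q_def sum_subtractf sum_negf sum_distrib_left)
  moreover have "0 \<le> c * (\<Sum>i\<in>UNIV. l i * (d i)\<^sup>2)"
    using l \<open>astar > 0\<close> by (auto simp: c_def intro!: mult_nonneg_nonneg sum_nonneg)
  ultimately show ?thesis using Q by (simp add: d_def)
qed

section \<open>The implicit time step on a finite connected weighted graph\<close>

locale weighted_graph =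
  fixes C :: "'c set" and m :: "'c \<Rightarrow> real" and \<tau> :: "'c \<Rightarrow> 'c \<Rightarrow> real"
  assumes finite_C: "finite C"
    and m_pos: "K \<in> C \<Longrightarrow> m K > 0"
    and \<tau>_nonneg: "\<tau> K L \<ge> 0"
    and \<tau>_sym: "\<tau> K L = \<tau> L K"
    and conn: "\<lbrakk>S \<subseteq> C; S \<noteq> {}; \<And>K L. \<lbrakk>K \<in> S; L \<in> C; \<tau> K L > 0\<rbrakk> \<Longrightarrow> L \<in> S\<rbrakk> \<Longrightarrow> S = C"
begin

text \<open>The sum runs over all of \<open>C\<close>, since non-adjacent pairs have weight 0.
  Connectedness (\<open>conn\<close>) is phrased through sets closed along positive edges, the form
  in which zeros of a species spread.\<close>

definition step_solution ::
  "real ^ 'n ^ 'n \<Rightarrow> real \<Rightarrow> real \<Rightarrow> ('c \<Rightarrow> real ^ 'n::finite) \<Rightarrow> ('c \<Rightarrow> real ^ 'n) \<Rightarrow> bool" where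
  "step_solution A astar dt V U \<longleftrightarrow> (\<forall>K\<in>C. \<forall>i.
     m K * ((U K $ i - V K $ i) / dt)
     + (\<Sum>L\<in>C. \<tau> K L * pair_flux A astar (U K) (U L) i) = 0)"

lemma edge_flux_antisym:
  "\<tau> L K * pair_flux A astar (U L) (U K) i = - (\<tau> K L * pair_flux A astar (U K) (U L) i)"
  by (subst \<tau>_sym, subst pair_flux_swap) simp

text \<open>Antisymmetric edge fluxes cancel in the sum over the cells.\<close>

lemma step_solution_mass:
  assumes "step_solution A astar dt V U" "dt > 0"
  shows "(\<Sum>K\<in>C. m K * U K $ i) = (\<Sum>K\<in>C. m K * V K $ i)"
proof -
  have "0 = (\<Sum>K\<in>C. m K * ((U K $ i - V K $ i) / dt)
     + (\<Sum>L\<in>C. \<tau> K L * pair_flux A astar (U K) (U L) i))"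
    by (intro sum.neutral[symmetric] ballI) (use assms in \<open>simp add: step_solution_def\<close>)
  also have "\<dots> = (\<Sum>K\<in>C. m K * ((U K $ i - V K $ i) / dt))"
    unfolding sum.distrib by (subst sum_antisym_eq_0[OF edge_flux_antisym]) simp
  also have "\<dots> = (\<Sum>K\<in>C. m K * (U K $ i - V K $ i)) / dt"
    by (simp add: sum_divide_distrib)
  finally show ?thesis
    using assms(2) by (simp add: right_diff_distrib sum_subtractf)
qed

text \<open>The cells without species \<open>i\<close> form a set closed along edges: in such a cell
  the time difference and all fluxes are \<le> 0, and a neighbour with a positive value would make
  one flux strictly negative. By connectedness species \<open>i\<close> would vanish everywhere,
  against its positive mass.\<close>

lemma step_solution_pos:
  assumes sol: "step_solution A astar dt V U" and "dt > 0"
    and A: "\<And>i j. A $ i $ j \<ge> 0" and astar: "astar > 0"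
    and U: "\<And>K. K \<in> C \<Longrightarrow> U K \<in> simplex_set" and V: "\<And>K. K \<in> C \<Longrightarrow> V K \<in> simplex_set"
    and mass: "(\<Sum>K\<in>C. m K * V K $ i) > 0" and "K \<in> C"
  shows "U K $ i > 0"
proof (rule ccontr)
  define S where "S = {K \<in> C. U K $ i = 0}"
  have nn: "U K $ i \<ge> 0" "V K $ i \<ge> 0" if "K \<in> C" for K
    using U[OF that] V[OF that] by (auto simp: simplex_set_def)
  assume "\<not> U K $ i > 0"
  then have "S \<noteq> {}" using nn \<open>K \<in> C\<close> by (force simp: S_def)
  moreover have "L \<in> S" if K: "K \<in> S" and L: "L \<in> C" "\<tau> K L > 0" for K L
  proof (rule ccontr)
    assume "L \<notin> S"
    then have UL: "U L $ i > 0" using L nn[of L] by (simp add: S_def)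
    have KC: "K \<in> C" and UK: "U K $ i = 0" using K by (auto simp: S_def)
    have np: "\<tau> K L' * pair_flux A astar (U K) (U L') i \<le> 0" if "L' \<in> C" for L'
    proof -
      have "pair_flux A astar (U K) (U L') i \<le> 0"
        unfolding pair_flux_eq_trunc_flux[OF U[OF KC] U[OF that]]
        by (rule trunc_flux_nonpos) (use A astar UK U[OF KC] U[OF that] in \<open>auto simp: simplex_set_def\<close>)
      then show ?thesis using \<tau>_nonneg by (rule mult_nonneg_nonpos[rotated])
    qed
    have "(\<Sum>L\<in>C. \<tau> K L * pair_flux A astar (U K) (U L) i) < 0"
    proof -
      have "(\<Sum>L\<in>C. \<tau> K L * pair_flux A astar (U K) (U L) i) < (\<Sum>L\<in>C. 0)"
        by (rule sum_strict_mono_ex1)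
           (use finite_C np L pair_flux_neg[OF A astar U[OF KC] U[OF L(1)] UK UL] in
             \<open>auto intro!: bexI[of _ L] mult_pos_neg\<close>)
      then show ?thesis by simp
    qed
    moreover have "m K * ((U K $ i - V K $ i) / dt) \<le> 0"
      using m_pos[OF KC] nn[OF KC] UK \<open>dt > 0\<close> by (simp add: divide_nonpos_pos mult_nonneg_nonneg)
    moreover have "m K * ((U K $ i - V K $ i) / dt)
        + (\<Sum>L\<in>C. \<tau> K L * pair_flux A astar (U K) (U L) i) = 0"
      using sol KC unfolding step_solution_def by blast
    ultimately show False by linarith
  qed
  moreover have "S \<subseteq> C" by (auto simp: S_def)
  ultimately have "S = C" by (intro conn) auto
  then have "(\<Sum>K\<in>C. m K * U K $ i) = 0"
    by (auto simp: S_def intro!: sum.neutral)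
  then show False using step_solution_mass[OF sol \<open>dt > 0\<close>] mass by simp
qed

text \<open>The scheme is tested with \<open>ln (U K $ i)\<close>. Convexity bounds the change of
  entropy by the tested time difference, and summation by parts turns the tested fluxes into the
  expression of \<open>pair_flux_dissipation\<close>.\<close>

lemma step_solution_entropy:
  assumes sol: "step_solution A astar dt V U" and dt: "dt > 0"
    and sym: "transpose A = A" and A: "\<And>i j. A $ i $ j \<ge> 0" and astar: "astar > 0"
    and U: "\<And>K. K \<in> C \<Longrightarrow> U K \<in> simplex_set" and V: "\<And>K. K \<in> C \<Longrightarrow> V K \<in> simplex_set"
    and pos: "\<And>K i. K \<in> C \<Longrightarrow> U K $ i > 0"
  shows "(\<Sum>K\<in>C. \<Sum>i\<in>UNIV. m K * U K $ i * ln (U K $ i))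
       \<le> (\<Sum>K\<in>C. \<Sum>i\<in>UNIV. m K * V K $ i * ln (V K $ i))"
proof -
  define \<Phi> where "\<Phi> = (\<lambda>K L i. \<tau> K L * pair_flux A astar (U K) (U L) i)"
  \<comment> \<open>Tangent inequality for \<open>u * ln u\<close>, whose derivative is
    \<open>ln u + 1\<close>. The case \<open>v = 0\<close> relies on
    \<open>0 * ln 0 = 0\<close>.\<close>
  have convex: "u * ln u - v * ln v \<le> (u - v) * ln u + (u - v)" if "u > 0" "v \<ge> 0" for u v :: real
  proof (cases "v = 0")
    case False
    then have v: "v > 0" using that by simp
    have "ln u - ln v = ln (u / v)" using that v by (simp add: ln_div)
    also have "\<dots> \<le> u / v - 1" using that v by (intro ln_le_minus_one) simp
    finally have "v * (ln u - ln v) \<le> v * (u / v - 1)" using v by (intro mult_left_mono) auto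
    then show ?thesis using v by (simp add: algebra_simps)
  qed (use that in simp)
  have E: "(\<Sum>K\<in>C. \<Sum>i\<in>UNIV. m K * U K $ i * ln (U K $ i))
       - (\<Sum>K\<in>C. \<Sum>i\<in>UNIV. m K * V K $ i * ln (V K $ i))
     \<le> (\<Sum>K\<in>C. \<Sum>i\<in>UNIV. m K * (U K $ i - V K $ i) * ln (U K $ i))"
  proof -
    have "(\<Sum>i\<in>UNIV. m K * U K $ i * ln (U K $ i)) - (\<Sum>i\<in>UNIV. m K * V K $ i * ln (V K $ i))
       \<le> (\<Sum>i\<in>UNIV. m K * (U K $ i - V K $ i) * ln (U K $ i))" if K: "K \<in> C" for K
    proof -
      have "(\<Sum>i\<in>UNIV. m K * U K $ i * ln (U K $ i)) - (\<Sum>i\<in>UNIV. m K * V K $ i * ln (V K $ i))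
        = (\<Sum>i\<in>UNIV. m K * (U K $ i * ln (U K $ i) - V K $ i * ln (V K $ i)))"
        by (simp add: sum_subtractf algebra_simps)
      also have "\<dots> \<le> (\<Sum>i\<in>UNIV. m K * ((U K $ i - V K $ i) * ln (U K $ i) + (U K $ i - V K $ i)))"
        using K V[OF K] m_pos[OF K]
        by (intro sum_mono mult_left_mono convex pos) (auto simp: simplex_set_def)
      also have "\<dots> = (\<Sum>i\<in>UNIV. m K * (U K $ i - V K $ i) * ln (U K $ i))
          + m K * ((\<Sum>i\<in>UNIV. U K $ i) - (\<Sum>i\<in>UNIV. V K $ i))"
        unfolding sum_subtractf[symmetric] sum_distrib_left sum.distrib[symmetric]
        by (simp add: algebra_simps)
      \<comment> \<open>The constant 1 in the derivative contributes only this difference of two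
        sums over the species, both equal to 1.\<close>
      also have "(\<Sum>i\<in>UNIV. U K $ i) - (\<Sum>i\<in>UNIV. V K $ i) = 0"
        using U[OF K] V[OF K] by (simp add: simplex_set_def)
      finally show ?thesis by simp
    qed
    then show ?thesis by (simp add: sum_subtractf[symmetric] sum_mono)
  qed
  have mU: "m K * (U K $ i - V K $ i) = - dt * (\<Sum>L\<in>C. \<Phi> K L i)" if "K \<in> C" for K i
  proof -
    have "m K * ((U K $ i - V K $ i) / dt) = - (\<Sum>L\<in>C. \<Phi> K L i)"
      using sol that unfolding step_solution_def \<Phi>_def by (simp add: eq_neg_iff_add_eq_0)
    then show ?thesis using dt by (simp add: field_simps)
  qed
  \<comment> \<open>\<open>W\<close> collects the tested fluxes. Adding its copy with
    \<open>K\<close> and \<open>L\<close> exchanged produces a difference of logarithms on each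
    edge.\<close>
  define W where "W = (\<Sum>K\<in>C. \<Sum>L\<in>C. \<Sum>i\<in>UNIV. \<Phi> K L i * ln (U K $ i))"
  have "(\<Sum>i\<in>UNIV. m K * (U K $ i - V K $ i) * ln (U K $ i))
      = - dt * (\<Sum>L\<in>C. \<Sum>i\<in>UNIV. \<Phi> K L i * ln (U K $ i))" if "K \<in> C" for K
    unfolding mU[OF that] sum.swap[of _ UNIV C]
    by (simp add: sum_distrib_left sum_distrib_right mult.assoc sum_negf)
  then have "(\<Sum>K\<in>C. \<Sum>i\<in>UNIV. m K * (U K $ i - V K $ i) * ln (U K $ i)) = - dt * W"
    unfolding W_def by (simp add: sum_distrib_left sum_negf)
  moreover have "W \<ge> 0"
  proof -
    have "W = (\<Sum>L\<in>C. \<Sum>K\<in>C. \<Sum>i\<in>UNIV. \<Phi> K L i * ln (U K $ i))"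
      unfolding W_def by (rule sum.swap)
    also have "\<dots> = (\<Sum>K\<in>C. \<Sum>L\<in>C. \<Sum>i\<in>UNIV. - (\<Phi> K L i) * ln (U L $ i))"
      unfolding \<Phi>_def by (intro sum.cong refl) (subst edge_flux_antisym, rule refl)
    finally have "W + W = (\<Sum>K\<in>C. \<Sum>L\<in>C. \<Sum>i\<in>UNIV. \<Phi> K L i * ln (U K $ i))
        + (\<Sum>K\<in>C. \<Sum>L\<in>C. \<Sum>i\<in>UNIV. - (\<Phi> K L i) * ln (U L $ i))"
      by (rule arg_cong2[where f = "(+)", OF W_def])
    also have "\<dots> = (\<Sum>K\<in>C. \<Sum>L\<in>C. - (\<tau> K L *
        (\<Sum>i\<in>UNIV. pair_flux A astar (U K) (U L) i * (ln (U L $ i) - ln (U K $ i)))))"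
      unfolding \<Phi>_def sum.distrib[symmetric] sum_distrib_left sum_negf[symmetric]
      by (intro sum.cong refl) (simp add: algebra_simps)
    also have "\<dots> \<ge> 0"
      by (intro sum_nonneg neg_0_le_iff_le[THEN iffD2] mult_nonneg_nonpos \<tau>_nonneg
          pair_flux_dissipation sym A astar U pos)
    finally show ?thesis by simp
  qed
  ultimately show ?thesis using E dt by (smt (verit) mult_nonneg_nonneg mult_minus_left)
qed

lemma step_solution_exists:
  assumes dt: "dt > 0"
    and sym: "transpose A = A" and A: "\<And>i j. A $ i $ j \<ge> 0" and astar: "astar > 0"
    and V: "\<And>K. K \<in> C \<Longrightarrow> V K \<in> simplex_set"
  obtains U :: "'c \<Rightarrow> real ^ 'n::finite"
  where "step_solution A astar dt V U" and "\<And>K. K \<in> C \<Longrightarrow> U K \<in> simplex_set"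
proof -
  \<comment> \<open>The unknowns are indexed by pairs of a cell and a species, and \<open>G\<close>
    is the residual of the scheme with the truncated flux.\<close>
  define I where "I = C \<times> (UNIV :: 'n set)"
  define st :: "('c \<times> 'n \<Rightarrow> real) \<Rightarrow> 'c \<Rightarrow> real ^ 'n" where "st = (\<lambda>z K. \<chi> i. z (K, i))"
  define G where "G = (\<lambda>z (K, i). m K * ((z (K, i) - V K $ i) / dt)
     + (\<Sum>L\<in>C. \<tau> K L * trunc_flux A astar (st z K) (st z L) i))"
  have "finite I" using finite_C by (simp add: I_def)
  then obtain z where z01: "\<And>k. k \<in> I \<Longrightarrow> z k \<in> {0..1}"
    and z0: "\<And>k. k \<in> I \<Longrightarrow> z k = 0 \<or> G z k \<le> 0"
    and z1: "\<And>k. k \<in> I \<Longrightarrow> z k = 1 \<or> G z k \<ge> 0"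
  proof (rule box_complementarity[of I G])
    fix X :: "nat \<Rightarrow> 'c \<times> 'n \<Rightarrow> real" and x k
    assume X: "\<And>n j. j \<in> I \<Longrightarrow> X n j \<in> {0..1}"
      and lim: "\<And>j. j \<in> I \<Longrightarrow> (\<lambda>n. X n j) \<longlonglongrightarrow> x j" and k: "k \<in> I"
    obtain K i where Ki: "k = (K, i)" "K \<in> C" using k by (auto simp: I_def)
    have x: "0 \<le> x (L, j)" if "L \<in> C" for L j
      by (rule LIMSEQ_le_const[OF lim]) (use that X in \<open>auto simp: I_def\<close>)
    have lm: "(\<lambda>n. log_mean (X n (K, j)) (X n (L, j))) \<longlonglongrightarrow> log_mean (x (K, j)) (x (L, j))"
      if "L \<in> C" for L j
      by (intro tendsto_log_mean lim) (use that Ki X x in \<open>auto simp: I_def\<close>)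
    show "(\<lambda>n. G (X n) k) \<longlonglongrightarrow> G x k"
      unfolding G_def Ki prod.case trunc_flux_def st_def vec_lambda_beta
      by (intro tendsto_intros lm lim) (use dt Ki in \<open>auto simp: I_def\<close>)
  qed (use that in blast)
  define u where "u = st z"
  have u: "0 \<le> u K $ i" "u K $ i \<le> 1" if "K \<in> C" for K i
    using z01[of "(K, i)"] that by (auto simp: u_def st_def I_def)
  define g where "g = (\<lambda>K i. m K * ((u K $ i - V K $ i) / dt)
     + (\<Sum>L\<in>C. \<tau> K L * trunc_flux A astar (u K) (u L) i))"
  have g0: "u K $ i = 0 \<or> g K i \<le> 0" and g1: "u K $ i = 1 \<or> g K i \<ge> 0" if "K \<in> C" for K i
    using z0[of "(K, i)"] z1[of "(K, i)"] that by (auto simp: u_def st_def I_def G_def g_def)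
  \<comment> \<open>Complementarity gives this only where the value is positive; at a zero it
    follows from \<open>trunc_flux_nonpos\<close> and the sign of the time difference.\<close>
  have g_nonpos: "g K i \<le> 0" if K: "K \<in> C" for K i
  proof (cases "u K $ i = 0")
    case True
    have "(\<Sum>L\<in>C. \<tau> K L * trunc_flux A astar (u K) (u L) i) \<le> 0"
      using True u K \<tau>_nonneg
      by (intro sum_nonpos mult_nonneg_nonpos trunc_flux_nonpos A astar) auto
    moreover have "m K * ((u K $ i - V K $ i) / dt) \<le> 0"
      using m_pos[OF K] V[OF K] True dt
      by (auto simp: simplex_set_def intro!: mult_nonneg_nonneg)
    ultimately show ?thesis by (simp add: g_def)
  qed (use g0 K in blast)
  define s where "s = (\<lambda>K. \<Sum>i\<in>UNIV. u K $ i)"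
  \<comment> \<open>Weights of the diffusion equation for the totals \<open>s\<close>, whose
    residual is the sum of the species residuals by \<open>sum_g\<close>.\<close>
  define w where "w = (\<lambda>K L. \<tau> K L * (astar * max 0 (1 - (\<Sum>j\<in>UNIV. log_mean (u K $ j) (u L $ j)))))"
  have w: "w K L \<ge> 0" for K L
    using \<tau>_nonneg astar by (auto simp: w_def intro!: mult_nonneg_nonneg)
  have sum_g: "(\<Sum>i\<in>UNIV. g K i) = m K * ((s K - 1) / dt) - (\<Sum>L\<in>C. w K L * (s L - s K))"
    if K: "K \<in> C" for K
  proof -
    have "(\<Sum>i\<in>UNIV. g K i) = (\<Sum>i\<in>UNIV. m K * ((u K $ i - V K $ i) / dt))
        + (\<Sum>L\<in>C. \<tau> K L * (\<Sum>i\<in>UNIV. trunc_flux A astar (u K) (u L) i))"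
      by (simp add: g_def sum.distrib sum.swap[of _ UNIV C] sum_distrib_left)
    also have "(\<Sum>i\<in>UNIV. m K * ((u K $ i - V K $ i) / dt)) = m K * ((s K - 1) / dt)"
      using V[OF K]
      by (simp add: s_def simplex_set_def sum_distrib_left[symmetric] sum_divide_distrib[symmetric]
          sum_subtractf)
    also have "(\<Sum>L\<in>C. \<tau> K L * (\<Sum>i\<in>UNIV. trunc_flux A astar (u K) (u L) i))
        = - (\<Sum>L\<in>C. w K L * (s L - s K))"
      unfolding sum_trunc_flux[OF sym] by (simp add: w_def s_def sum_negf[symmetric] mult.assoc)
    finally show ?thesis by simp
  qed
  have s_le: "s K \<le> 1" if "K \<in> C" for K
  proof -
    have fin: "finite (s ` C)" "s ` C \<noteq> {}" using finite_C that by auto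
    then obtain K0 where K0: "K0 \<in> C" "s K0 = Max (s ` C)" using Max_in by (metis imageE)
    have le: "s L \<le> s K0" if "L \<in> C" for L using K0 fin that by simp
    have "(\<Sum>L\<in>C. w K0 L * (s L - s K0)) \<le> 0"
      using w le by (intro sum_nonpos mult_nonneg_nonpos) auto
    moreover have "(\<Sum>i\<in>UNIV. g K0 i) \<le> 0" using g_nonpos[OF K0(1)] by (intro sum_nonpos) auto
    ultimately have "m K0 * ((s K0 - 1) / dt) \<le> 0" using sum_g[OF K0(1)] by linarith
    then have "s K0 \<le> 1"
      using m_pos[OF K0(1)] dt by (simp add: mult_le_0_iff divide_le_0_iff)
    then show ?thesis using le[OF that] by linarith
  qed
  have s_ge: "s K \<ge> 1" if "K \<in> C" for K
  proof -
    have fin: "finite (s ` C)" "s ` C \<noteq> {}" using finite_C that by auto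
    then obtain K0 where K0: "K0 \<in> C" "s K0 = Min (s ` C)" using Min_in by (metis imageE)
    have le: "s K0 \<le> s L" if "L \<in> C" for L using K0 fin that by simp
    \<comment> \<open>If the minimum of \<open>s\<close> were below 1, no component in
      \<open>K0\<close> could reach the upper end of the cube, so all residuals there would be \<ge>
      0.\<close>
    have "s K0 \<ge> 1"
    proof (rule ccontr)
      assume "\<not> s K0 \<ge> 1"
      moreover have "u K0 $ i \<le> s K0" for i
        unfolding s_def using u[OF K0(1)] by (intro member_le_sum) auto
      ultimately have "u K0 $ i \<noteq> 1" for i by (metis not_le order_refl)
      then have "(\<Sum>i\<in>UNIV. g K0 i) \<ge> 0" using g1[OF K0(1)] by (intro sum_nonneg) auto
      moreover have "(\<Sum>L\<in>C. w K0 L * (s L - s K0)) \<ge> 0"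
        using w le by (intro sum_nonneg mult_nonneg_nonneg) auto
      ultimately have "m K0 * ((s K0 - 1) / dt) \<ge> 0" using sum_g[OF K0(1)] by linarith
      then show False
        using m_pos[OF K0(1)] dt \<open>\<not> s K0 \<ge> 1\<close> by (simp add: zero_le_mult_iff zero_le_divide_iff)
    qed
    then show ?thesis using le[OF that] by linarith
  qed
  have s1: "s K = 1" if "K \<in> C" for K using s_le[OF that] s_ge[OF that] by simp
  have simplex: "u K \<in> simplex_set" if "K \<in> C" for K
    using u s1 that by (simp add: simplex_set_def s_def)
  have g_eq: "g K i = 0" if K: "K \<in> C" for K i
  proof -
    have "(\<Sum>i\<in>UNIV. - g K i) = 0" using sum_g[OF K] s1 K by (simp add: sum_negf)
    then show ?thesis using g_nonpos[OF K] by (subst (asm) sum_nonneg_eq_0_iff) auto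
  qed
  have "step_solution A astar dt V u"
    unfolding step_solution_def
  proof (intro ballI allI)
    fix K i assume K: "K \<in> C"
    have "(\<Sum>L\<in>C. \<tau> K L * pair_flux A astar (u K) (u L) i)
      = (\<Sum>L\<in>C. \<tau> K L * trunc_flux A astar (u K) (u L) i)"
      using K simplex by (intro sum.cong refl) (simp add: pair_flux_eq_trunc_flux)
    then show "m K * ((u K $ i - V K $ i) / dt)
      + (\<Sum>L\<in>C. \<tau> K L * pair_flux A astar (u K) (u L) i) = 0"
      using g_eq[OF K, of i] by (simp add: g_def)
  qed
  then show thesis using simplex by (rule that)
qed

end

section \<open>Hausdorff null sets\<close>

lemma hausdorff_mono:
  assumes "S \<subseteq> T"
  shows "hausdorff k S \<le> hausdorff k T"
  unfolding hausdorff_def hausdorff_pre_def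
  by (intro SUP_mono' INF_superset_mono) (use assms in auto)

lemma hausdorff_null_cover:
  assumes "hausdorff k S = 0" "\<delta> > 0" "e > 0"
  obtains C where "S \<subseteq> (\<Union>n. C n)" "\<And>n. bounded (C n)" "\<And>n. diameter (C n) \<le> \<delta>"
    "(\<Sum>n. hausdorff_weight k (C n)) < e"
proof -
  have "hausdorff_pre k \<delta> S \<le> hausdorff k S"
    unfolding hausdorff_def using assms(2) by (intro SUP_upper) simp
  then have "hausdorff_pre k \<delta> S < e" using assms by simp
  then show thesis
    unfolding hausdorff_pre_def INF_less_iff using that by blast
qed

lemma hausdorff_eq_0I:
  assumes "\<And>\<delta> e :: real. \<lbrakk>\<delta> > 0; e > 0\<rbrakk> \<Longrightarrow> \<exists>C. S \<subseteq> (\<Union>n. C n) \<and>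
    (\<forall>n. bounded (C n) \<and> diameter (C n) \<le> \<delta>) \<and> (\<Sum>n. hausdorff_weight k (C n)) \<le> ennreal e"
  shows "hausdorff k S = 0"
proof -
  have "hausdorff_pre k \<delta> S \<le> 0" if "\<delta> > 0" for \<delta>
  proof (rule ennreal_le_epsilon)
    fix e :: real assume "0 < e"
    from assms[OF \<open>\<delta> > 0\<close> this] obtain C where C: "S \<subseteq> (\<Union>n. C n)"
      "\<forall>n. bounded (C n) \<and> diameter (C n) \<le> \<delta>" "(\<Sum>n. hausdorff_weight k (C n)) \<le> ennreal e"
      by (elim exE conjE)
    have "hausdorff_pre k \<delta> S \<le> (\<Sum>n. hausdorff_weight k (C n))"
      unfolding hausdorff_pre_def by (rule INF_lower) (use C in blast)
    then show "hausdorff_pre k \<delta> S \<le> 0 + ennreal e" using C(3) by simp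
  qed
  then show ?thesis unfolding hausdorff_def by (auto intro!: antisym SUP_least)
qed

lemma hausdorff_empty: "hausdorff k {} = 0"
  by (rule hausdorff_eq_0I) (auto intro!: exI[of _ "\<lambda>_. {}"] simp: hausdorff_weight_def)

text \<open>Serves to merge two countable covers into one by the parity of the index; partial sums
  up to \<open>2 * N\<close> split exactly.\<close>

lemma suminf_interleave_le:
  fixes f g :: "nat \<Rightarrow> ennreal"
  shows "(\<Sum>n. if even n then f (n div 2) else g (n div 2)) \<le> suminf f + suminf g"
proof -
  define h where "h = (\<lambda>n. if even n then f (n div 2) else g (n div 2))"
  have eq: "sum h {..<2 * N} = sum f {..<N} + sum g {..<N}" for N
    by (induction N) (simp_all add: h_def ac_simps)
  \<comment> \<open>The \<open>+ 0\<close> gives the bound the shape that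
    \<open>ennreal_suminf_bound_add\<close> expects.\<close>
  have "sum h {..<N} + 0 \<le> suminf f + suminf g" for N
  proof -
    have "sum h {..<N} \<le> sum h {..<2 * N}" by (intro sum_mono2) auto
    also have "\<dots> \<le> suminf f + suminf g"
      unfolding eq by (intro add_mono sum_le_suminf summableI) auto
    finally show ?thesis by simp
  qed
  then have "suminf h + 0 \<le> suminf f + suminf g" by (rule ennreal_suminf_bound_add)
  then show ?thesis by (simp add: h_def)
qed

text \<open>Two covers, each of total weight below \<open>e / 2\<close>, are interleaved into one
  sequence.\<close>

lemma hausdorff_null_Un:
  assumes S: "hausdorff k S = 0" and T: "hausdorff k T = 0"
  shows "hausdorff k (S \<union> T) = 0"
proof (rule hausdorff_eq_0I)
  fix \<delta> e :: real assume "\<delta> > 0" "e > 0"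
  then have e: "ennreal (e / 2) > 0" by simp
  obtain C where C: "S \<subseteq> (\<Union>n. C n)" "\<And>n. bounded (C n)" "\<And>n. diameter (C n) \<le> \<delta>"
    "(\<Sum>n. hausdorff_weight k (C n)) < ennreal (e / 2)"
    by (rule hausdorff_null_cover[OF S \<open>\<delta> > 0\<close> e], rule that)
  obtain D where D: "T \<subseteq> (\<Union>n. D n)" "\<And>n. bounded (D n)" "\<And>n. diameter (D n) \<le> \<delta>"
    "(\<Sum>n. hausdorff_weight k (D n)) < ennreal (e / 2)"
    by (rule hausdorff_null_cover[OF T \<open>\<delta> > 0\<close> e], rule that)
  define F where "F n = (if even n then C (n div 2) else D (n div 2))" for n
  have "S \<union> T \<subseteq> (\<Union>n. F n)"
  proof
    fix x assume "x \<in> S \<union> T"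
    then have "x \<in> (\<Union>n. C n) \<or> x \<in> (\<Union>n. D n)" using C(1) D(1) by blast
    then obtain n where "x \<in> C n \<or> x \<in> D n" by blast
    then have "x \<in> F (2 * n) \<or> x \<in> F (2 * n + 1)" by (simp add: F_def)
    then show "x \<in> (\<Union>n. F n)" by blast
  qed
  moreover have "\<forall>n. bounded (F n) \<and> diameter (F n) \<le> \<delta>" using C(2,3) D(2,3) by (simp add: F_def)
  moreover have "(\<Sum>n. hausdorff_weight k (F n)) \<le> ennreal e"
  proof -
    have "(\<Sum>n. hausdorff_weight k (F n)) = (\<Sum>n. if even n then hausdorff_weight k (C (n div 2))
        else hausdorff_weight k (D (n div 2)))"
      by (intro arg_cong[where f = suminf] ext) (simp add: F_def)
    also have "\<dots> \<le> (\<Sum>n. hausdorff_weight k (C n)) + (\<Sum>n. hausdorff_weight k (D n))"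
      by (rule suminf_interleave_le)
    also have "\<dots> \<le> ennreal (e / 2) + ennreal (e / 2)"
      using C(4) D(4) by (intro add_mono less_imp_le)
    also have "\<dots> = ennreal e" using \<open>e > 0\<close> by (simp flip: ennreal_plus)
    finally show ?thesis .
  qed
  ultimately show "\<exists>C. S \<union> T \<subseteq> (\<Union>n. C n) \<and> (\<forall>n. bounded (C n) \<and> diameter (C n) \<le> \<delta>) \<and>
      (\<Sum>n. hausdorff_weight k (C n)) \<le> ennreal e"
    by blast
qed

lemma hausdorff_null_UN:
  "finite I \<Longrightarrow> (\<And>i. i \<in> I \<Longrightarrow> hausdorff k (S i) = 0) \<Longrightarrow> hausdorff k (\<Union>i\<in>I. S i) = 0"
  by (induction I rule: finite_induct) (auto simp: hausdorff_empty intro!: hausdorff_null_Un)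

text \<open>Box counting: with respect to an orthonormal basis of its span, the set is covered by
  \<open>O(n\<^sup>d)\<close> pieces of diameter \<open>O(1/n)\<close>, where \<open>d < k\<close>.\<close>

lemma hausdorff_lowdim:
  fixes S :: "'a::euclidean_space set"
  assumes "bounded S" and dim: "aff_dim S < int k"
  shows "hausdorff k S = 0"
proof (cases "S = {}")
  case True
  then show ?thesis by (simp add: hausdorff_empty)
next
  case False
  then obtain p where p: "p \<in> S" by blast
  \<comment> \<open>Direction space of the affine hull of \<open>S\<close>, seen from
    \<open>p\<close>; its dimension is \<open>aff_dim S\<close>.\<close>
  define V where "V = span ((+) (- p) ` S)"
  have "subspace V" by (simp add: V_def)
  then obtain B where B: "B \<subseteq> V" "pairwise orthogonal B" "\<And>b. b \<in> B \<Longrightarrow> norm b = 1"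
    "independent B" "card B = dim V" "span B = V"
    using orthonormal_basis_subspace[of V] by metis
  define d where "d = card B"
  have "finite B" using B(4) by (rule finiteI_independent)
  have "aff_dim S = int d"
    using aff_dim_eq_dim[of p S] p by (simp add: d_def B(5) V_def hull_inc)
  then have dk: "d < k" using dim by simp
  obtain R where R: "R > 0" "\<And>x. x \<in> S \<Longrightarrow> norm (x - p) \<le> R"
  proof -
    have "bounded ((\<lambda>x. x - p) ` S)" using \<open>bounded S\<close> by (rule bounded_translation_minus)
    then obtain R where "R > 0" "\<forall>x\<in>(\<lambda>x. x - p) ` S. norm x \<le> R" by (meson bounded_pos)
    then show thesis using that by blast
  qed
  have diffV: "x - y \<in> V" if "x \<in> S" "y \<in> S" for x y
  proof -
    have "(- p + x) - (- p + y) \<in> V"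
      unfolding V_def using that by (intro span_diff span_base) auto
    then show ?thesis by simp
  qed
  \<comment> \<open>\<open>c / n\<close> will bound the total weight: there are at most
    \<open>(3 * n) ^ d\<close> pieces of diameter at most \<open>d * R / n\<close>, and
    \<open>d < k\<close> leaves at least one factor \<open>1 / n\<close>.\<close>
  define c where "c = unit_ball_vol (real k) * 3 ^ d * (real d * R / 2) ^ k"
  show ?thesis
  proof (rule hausdorff_eq_0I)
    fix \<delta> e :: real assume \<delta>: "\<delta> > 0" and e: "e > 0"
    obtain n1 n2 :: nat where n12: "real d * R / \<delta> < real n1" "c / e < real n2"
      using reals_Archimedean2 by metis
    \<comment> \<open>The two thresholds bring the diameters down to \<open>\<delta>\<close> and the
      total weight down to \<open>e\<close>.\<close>
    define n where "n = max 1 (max n1 n2)"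
    have n: "n \<ge> 1" "real d * R / \<delta> \<le> real n" "c / e \<le> real n"
      using n12 by (auto simp: n_def)
    define h where "h = R / real n"
    have h: "h > 0" using R n by (simp add: h_def)
    \<comment> \<open>Grid index of \<open>x\<close> in orthonormal coordinates. Coordinates are
      bounded by \<open>R = n * h\<close>, so the entries lie between \<open>- n\<close> and
      \<open>n\<close>; \<open>restrict\<close> puts the index into the finite set
      \<open>J\<close>.\<close>
    define idx where "idx x = restrict (\<lambda>b. \<lfloor>((x - p) \<bullet> b) / h\<rfloor>) B" for x
    define J where "J = PiE B (\<lambda>_. {- int n..int n})"
    have "finite J" unfolding J_def using \<open>finite B\<close> by (intro finite_PiE) auto
    have cardJ: "card J = (2 * n + 1) ^ d"
    proof -
      have "nat (int n + 1 + int n) = 2 * n + 1" by simp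
      then show ?thesis by (simp add: J_def card_PiE[OF \<open>finite B\<close>] d_def)
    qed
    have idxJ: "idx x \<in> J" if x: "x \<in> S" for x
    proof -
      have "\<lfloor>((x - p) \<bullet> b) / h\<rfloor> \<in> {- int n..int n}" if b: "b \<in> B" for b
      proof -
        have "\<bar>(x - p) \<bullet> b\<bar> \<le> norm (x - p) * norm b" by (rule Cauchy_Schwarz_ineq2)
        also have "\<dots> \<le> R" using R(2)[OF x] B(3)[OF b] by simp
        finally have "\<bar>((x - p) \<bullet> b) / h\<bar> \<le> real n"
          using h n R by (simp add: h_def field_simps abs_mult)
        then have "- real n \<le> ((x - p) \<bullet> b) / h" "((x - p) \<bullet> b) / h \<le> real n" by linarith+
        then show ?thesis by (simp add: le_floor_iff floor_le_iff)
      qed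
      then show ?thesis by (auto simp: idx_def J_def)
    qed
    define cell where "cell j = {x \<in> S. idx x = j}" for j
    have diam: "diameter (cell j) \<le> real d * h" for j
    proof (rule diameter_le)
      show "cell j \<noteq> {} \<or> 0 \<le> real d * h" using h by simp
      fix x y assume xy: "x \<in> cell j" "y \<in> cell j"
      have V: "x - y \<in> span B" using xy diffV B(6) by (auto simp: cell_def)
      have "\<bar>(x - y) \<bullet> b\<bar> \<le> h" if b: "b \<in> B" for b
      proof -
        have "idx x b = idx y b" using xy by (simp add: cell_def)
        then have "\<lfloor>((x - p) \<bullet> b) / h\<rfloor> = \<lfloor>((y - p) \<bullet> b) / h\<rfloor>" using b by (simp add: idx_def)
        then have "\<bar>((x - p) \<bullet> b) / h - ((y - p) \<bullet> b) / h\<bar> \<le> 1" by linarith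
        moreover have "((x - p) \<bullet> b) / h - ((y - p) \<bullet> b) / h = ((x - y) \<bullet> b) / h"
          by (simp add: diff_divide_distrib[symmetric] inner_diff_left)
        ultimately show ?thesis using h by simp
      qed
      then have "(\<Sum>b\<in>B. norm (((x - y) \<bullet> b) *\<^sub>R b)) \<le> (\<Sum>b\<in>B. h)"
        using B(3) by (intro sum_mono) simp
      moreover have "norm (\<Sum>b\<in>B. ((x - y) \<bullet> b) *\<^sub>R b) = norm (x - y)"
        using orthonormal_basis_expand[OF B(2,3) V \<open>finite B\<close>] by simp
      ultimately show "norm (x - y) \<le> real d * h"
        using norm_sum[of "\<lambda>b. ((x - y) \<bullet> b) *\<^sub>R b" B] by (simp add: d_def)
    qed
    have bdd: "bounded (cell j)" for j
      using \<open>bounded S\<close> by (rule bounded_subset) (auto simp: cell_def)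
    obtain f where f: "bij_betw f {0..<card J} J" using ex_bij_betw_nat_finite[OF \<open>finite J\<close>] by blast
    define C where "C m = (if m < card J then cell (f m) else {})" for m
    have dh\<delta>: "real d * h \<le> \<delta>"
      using n \<delta> by (simp add: h_def field_simps)
    have "S \<subseteq> (\<Union>m. C m)"
    proof
      fix x assume x: "x \<in> S"
      then obtain m where "m < card J" "f m = idx x"
        using idxJ[OF x] f unfolding bij_betw_def by (metis atLeastLessThan_iff imageE)
      then have "x \<in> C m" using x by (simp add: C_def cell_def)
      then show "x \<in> (\<Union>m. C m)" by blast
    qed
    moreover have "\<forall>m. bounded (C m) \<and> diameter (C m) \<le> \<delta>"
      using bdd order_trans[OF diam dh\<delta>] \<delta> by (simp add: C_def)
    moreover have "(\<Sum>m. hausdorff_weight k (C m)) \<le> ennreal e"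
    proof -
      define w where "w = unit_ball_vol (real k) * (real d * h / 2) ^ k"
      have w: "hausdorff_weight k (C m) \<le> ennreal w" for m
        using diam[of "f m"] diameter_ge_0[OF bdd[of "f m"]]
        by (auto simp: hausdorff_weight_def C_def w_def
            intro!: ennreal_leI mult_left_mono power_mono)
      have "w \<ge> 0" using h by (simp add: w_def)
      have "(\<Sum>m. hausdorff_weight k (C m)) = (\<Sum>m<card J. hausdorff_weight k (C m))"
        by (rule suminf_finite) (auto simp: C_def hausdorff_weight_def)
      also have "\<dots> \<le> (\<Sum>m<card J. ennreal w)" by (intro sum_mono w)
      also have "\<dots> = ennreal (real (card J) * w)"
        using \<open>w \<ge> 0\<close> by (simp add: ennreal_mult ennreal_of_nat_eq_real_of_nat)
      also have "real (card J) * w \<le> e"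
      proof -
        have npos: "real n > 0" using n by simp
        have "real (card J) = (2 * real n + 1) ^ d" by (simp add: cardJ add.commute)
        also have "\<dots> \<le> (3 * real n) ^ d" using n by (intro power_mono) auto
        finally have "real (card J) * w \<le> (3 * real n) ^ d * w"
          using \<open>w \<ge> 0\<close> by (rule mult_right_mono)
        also have "\<dots> = c * (real n ^ d / real n ^ k)"
          by (simp add: w_def c_def h_def power_mult_distrib power_divide mult_ac)
        also have "real n ^ d / real n ^ k \<le> 1 / real n"
        proof -
          have "real n ^ Suc d \<le> real n ^ k" using n dk by (intro power_increasing) auto
          then show ?thesis using npos by (simp add: field_simps)
        qed
        then have "c * (real n ^ d / real n ^ k) \<le> c * (1 / real n)"
          using R by (intro mult_left_mono) (auto simp: c_def)
        also have "\<dots> \<le> e" using n(3) e npos by (simp add: field_simps)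
        finally show ?thesis .
      qed
      finally show ?thesis by (simp add: ennreal_leI)
    qed
    ultimately show "\<exists>C. S \<subseteq> (\<Union>n. C n) \<and> (\<forall>n. bounded (C n) \<and> diameter (C n) \<le> \<delta>) \<and>
        (\<Sum>n. hausdorff_weight k (C n)) \<le> ennreal e"
      by blast
  qed
qed

section \<open>The volume of a tube over a surface-null set\<close>

definition tube :: "'a::real_vector \<Rightarrow> 'a set \<Rightarrow> 'a set" where
  "tube v S = {z + s *\<^sub>R v | z s. z \<in> S \<and> s \<in> {0..1}}"

text \<open>A tube over a set of diameter less than \<open>r\<close> is covered by \<open>O(1/r)\<close> balls of radius \<open>O(r)\<close>.\<close>

lemma tube_cover:
  fixes v :: "'a::euclidean_space"
  assumes "bounded C" "diameter C < r" "0 < r" "r \<le> 2"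
  obtains T where "T \<in> sets borel" "tube v C \<subseteq> T"
    "emeasure lborel T \<le> ennreal (5 * unit_ball_vol DIM('a) * (1 + norm v) ^ DIM('a) * r ^ (DIM('a) - 1))"
proof (cases "C = {}")
  case True
  then show thesis using that[of "{}"] by (simp add: tube_def)
next
  case False
  then obtain c where c: "c \<in> C" by blast
  \<comment> \<open>Number of steps along \<open>v\<close>. A parameter step of at most
    \<open>r\<close> moves a point by at most \<open>r * norm v\<close>, and the set itself extends
    by at most \<open>r\<close>; this gives the radius \<open>\<rho>\<close>.\<close>
  define N where "N = nat \<lceil>1 / r\<rceil>"
  have N: "1 / r \<le> real N" "real N \<le> 1 / r + 1" using \<open>0 < r\<close> by (auto simp: N_def; linarith)+
  have Npos: "real N > 0" using N(1) \<open>0 < r\<close> by (smt (verit) divide_pos_pos)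
  define \<rho> where "\<rho> = (1 + norm v) * r"
  have \<rho>: "\<rho> \<ge> 0" using \<open>0 < r\<close> by (simp add: \<rho>_def)
  define b where "b i = cball (c + (real i / real N) *\<^sub>R v) \<rho>" for i
  define T where "T = (\<Union>i\<in>{..N}. b i)"
  have T: "T \<in> sets borel" by (auto simp: T_def b_def)
  have "tube v C \<subseteq> T"
  proof
    fix y assume "y \<in> tube v C"
    then obtain z s where y: "y = z + s *\<^sub>R v" "z \<in> C" "0 \<le> s" "s \<le> 1" by (auto simp: tube_def)
    define i where "i = nat \<lfloor>s * real N\<rfloor>"
    have "0 \<le> s * real N" using y by simp
    then have i: "real i \<le> s * real N" "s * real N < real i + 1" by (auto simp: i_def; linarith)+
    have "s * real N \<le> real N" using y Npos by (simp add: mult_left_le_one_le)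
    then have iN: "i \<le> N" using i by linarith
    have "s - real i / real N = (s * real N - real i) / real N"
      using Npos by (simp add: field_simps)
    then have "\<bar>s - real i / real N\<bar> \<le> 1 / real N"
      using i Npos by (simp add: divide_right_mono)
    also have "\<dots> \<le> r" using N(1) Npos \<open>0 < r\<close> by (simp add: field_simps)
    finally have si: "\<bar>s - real i / real N\<bar> \<le> r" .
    have "dist (c + (real i / real N) *\<^sub>R v) y = norm ((z - c) + (s - real i / real N) *\<^sub>R v)"
      by (simp add: y dist_norm norm_minus_commute algebra_simps)
    also have "\<dots> \<le> norm (z - c) + \<bar>s - real i / real N\<bar> * norm v"
      using norm_triangle_ineq[of "z - c" "(s - real i / real N) *\<^sub>R v"] by simp
    also have "\<dots> \<le> r + r * norm v"
    proof (intro add_mono mult_right_mono si)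
      show "norm (z - c) \<le> r"
        using diameter_bounded_bound[OF assms(1) y(2) c] assms(2) by (simp add: dist_norm)
    qed simp
    finally have "y \<in> b i" by (simp add: b_def \<rho>_def algebra_simps)
    then show "y \<in> T" using iN by (auto simp: T_def)
  qed
  moreover have "emeasure lborel T \<le> ennreal (5 * unit_ball_vol DIM('a) * (1 + norm v) ^ DIM('a) * r ^ (DIM('a) - 1))"
  proof -
    have "emeasure lborel T \<le> (\<Sum>i\<in>{..N}. emeasure lborel (b i))"
      unfolding T_def by (intro emeasure_subadditive_finite) (auto simp: b_def)
    also have "\<dots> = (\<Sum>i\<in>{..N}. ennreal (unit_ball_vol DIM('a) * \<rho> ^ DIM('a)))"
      unfolding b_def using \<rho> by (simp add: emeasure_cball)
    also have "\<dots> = ennreal (real (N + 1) * (unit_ball_vol DIM('a) * \<rho> ^ DIM('a)))"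
      using \<rho> by (simp add: ennreal_mult ennreal_of_nat_eq_real_of_nat)
    also have "real (N + 1) * (unit_ball_vol DIM('a) * \<rho> ^ DIM('a))
        \<le> (5 / r) * (unit_ball_vol DIM('a) * \<rho> ^ DIM('a))"
    proof (rule mult_right_mono)
      \<comment> \<open>The factor 5 stems from \<open>N + 1 \<le> 1 / r + 2\<close> and this bound,
        which uses \<open>r \<le> 2\<close>.\<close>
      have "2 \<le> 4 / r" using assms by (simp add: field_simps)
      then show "real (N + 1) \<le> 5 / r" using N(2) by simp
    qed (use \<rho> in simp)
    also have "\<dots> = 5 * unit_ball_vol DIM('a) * (1 + norm v) ^ DIM('a) * r ^ (DIM('a) - 1)"
    proof -
      have "\<rho> ^ DIM('a) = (1 + norm v) ^ DIM('a) * (r ^ (DIM('a) - 1) * r)"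
        unfolding \<rho>_def power_mult_distrib by (subst power_minus_mult) simp_all
      then show ?thesis using \<open>0 < r\<close> by simp
    qed
    finally show ?thesis by (simp add: ennreal_leI)
  qed
  ultimately show thesis using that T by blast
qed

text \<open>A cover of \<open>Z\<close> of small weight in dimension \<open>k = DIM('a) - 1\<close>
  yields a cover of the tube whose volume is at most \<open>q / u\<close> times that weight plus a
  summable slack.\<close>

lemma negligible_tube:
  fixes v :: "'a::euclidean_space"
  assumes "surface Z = 0"
  shows "negligible (tube v Z)"
  unfolding negligible_outer_le
proof (intro allI impI)
  fix e :: real assume e: "e > 0"
  define k where "k = DIM('a) - 1"
  define q where "q = 5 * unit_ball_vol DIM('a) * (1 + norm v) ^ DIM('a)"
  have q: "q > 0" unfolding q_def by (intro mult_pos_pos zero_less_power add_pos_nonneg) auto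
  define u where "u = unit_ball_vol (real k) / 2 ^ k"
  have u: "u > 0" by (simp add: u_def)
  \<comment> \<open>Chosen so that \<open>q / u * \<epsilon> = e / 2\<close>; the slacks
    \<open>q * \<eta> n\<close> sum to the other half.\<close>
  define \<epsilon> where "\<epsilon> = e * u / (2 * q)"
  have \<epsilon>: "\<epsilon> > 0" using e u q by (simp add: \<epsilon>_def)
  obtain C where C: "Z \<subseteq> (\<Union>n. C n)" "\<And>n. bounded (C n)" "\<And>n. diameter (C n) \<le> 1"
    "(\<Sum>n. hausdorff_weight k (C n)) < ennreal \<epsilon>"
  proof (rule hausdorff_null_cover[of k Z 1 "ennreal \<epsilon>"])
    show "hausdorff k Z = 0" using assms by (simp add: k_def)
    show "ennreal \<epsilon> > 0" using \<epsilon> by simp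
  qed (simp, rule that)
  \<comment> \<open>Slack for enlarging the diameter: \<open>tube_cover\<close> asks for a positive
    \<open>r\<close> strictly above the diameter, which may be 0.\<close>
  define \<eta> where "\<eta> n = e / (4 * q) * (1 / 2) ^ n" for n :: nat
  have \<eta>: "\<eta> n > 0" for n using e q by (simp add: \<eta>_def)
  have wt: "ennreal ((diameter (C n)) ^ k) \<le> ennreal (1 / u) * hausdorff_weight k (C n)"
    if "C n \<noteq> {}" for n
  proof -
    have "hausdorff_weight k (C n) = ennreal (u * diameter (C n) ^ k)"
      using that by (simp add: hausdorff_weight_def u_def power_divide)
    then show ?thesis
      using u diameter_ge_0[OF C(2)] by (simp flip: ennreal_mult)
  qed
  have "\<exists>T. T \<in> sets borel \<and> tube v (C n) \<subseteq> T \<and>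
      emeasure lborel T \<le> ennreal (q / u) * hausdorff_weight k (C n) + ennreal (q * \<eta> n)" for n
  proof (cases "C n = {}")
    case True
    then show ?thesis by (intro exI[of _ "{}"]) (simp add: tube_def)
  next
    case False
    define D where "D = diameter (C n)"
    have D: "0 \<le> D" "D \<le> 1" using C(2,3) by (auto simp: D_def diameter_ge_0)
    have "((\<lambda>r. r ^ k) \<longlongrightarrow> D ^ k) (at_right D)" by (intro tendsto_intros)
    then have "\<forall>\<^sub>F r in at_right D. r ^ k < D ^ k + \<eta> n"
      by (rule order_tendstoD) (use \<eta> in simp)
    moreover have "\<forall>\<^sub>F r in at_right D. r \<in> {D<..<2}"
      by (rule eventually_at_right_real) (use D in simp)
    ultimately have "\<forall>\<^sub>F r in at_right D. r ^ k < D ^ k + \<eta> n \<and> r \<in> {D<..<2}"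
      by (rule eventually_conj)
    then have "\<exists>r. r ^ k < D ^ k + \<eta> n \<and> r \<in> {D<..<2}"
      by (rule eventually_happens'[rotated]) simp
    then obtain r where r: "r ^ k < D ^ k + \<eta> n" "D < r" "r < 2" by auto
    obtain T where T: "T \<in> sets borel" "tube v (C n) \<subseteq> T"
      "emeasure lborel T \<le> ennreal (q * r ^ k)"
    proof (rule tube_cover[OF C(2), of n r v])
      show "diameter (C n) < r" "0 < r" "r \<le> 2" using r D by (simp_all add: D_def)
    qed (rule that, assumption+, simp only: q_def k_def)
    have "ennreal (q * r ^ k) \<le> ennreal (q * D ^ k + q * \<eta> n)"
      using r q by (intro ennreal_leI) (simp flip: distrib_left)
    also have "\<dots> = ennreal q * ennreal (D ^ k) + ennreal (q * \<eta> n)"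
      using q D \<eta>[of n] by (simp add: ennreal_mult)
    also have "\<dots> \<le> ennreal q * (ennreal (1 / u) * hausdorff_weight k (C n)) + ennreal (q * \<eta> n)"
      using wt[OF False] by (intro add_right_mono mult_left_mono) (auto simp: D_def)
    also have "ennreal q * (ennreal (1 / u) * hausdorff_weight k (C n))
        = ennreal (q / u) * hausdorff_weight k (C n)"
      using q u by (simp add: mult.assoc[symmetric] ennreal_mult[symmetric])
    finally have "emeasure lborel T \<le> ennreal (q / u) * hausdorff_weight k (C n) + ennreal (q * \<eta> n)"
      using T(3) by (rule order_trans[rotated])
    then show ?thesis using T(1,2) by (intro exI[of _ T] conjI)
  qed
  then obtain T where T: "\<And>n. T n \<in> sets borel" "\<And>n. tube v (C n) \<subseteq> T n"
    "\<And>n. emeasure lborel (T n) \<le> ennreal (q / u) * hausdorff_weight k (C n) + ennreal (q * \<eta> n)"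
    by metis
  define W where "W = (\<Union>n. T n)"
  have W: "W \<in> sets borel" using T(1) by (auto simp: W_def)
  have sub: "tube v Z \<subseteq> W"
  proof
    fix y assume "y \<in> tube v Z"
    then obtain z s where y: "y = z + s *\<^sub>R v" "z \<in> Z" "s \<in> {0..1}" by (auto simp: tube_def)
    then obtain n where "z \<in> C n" using C(1) by blast
    then have "y \<in> tube v (C n)" using y by (auto simp: tube_def)
    then show "y \<in> W" using T(2) by (auto simp: W_def)
  qed
  have "(\<lambda>n. q * \<eta> n) sums (q * (e / (4 * q) * (1 / (1 - 1 / 2))))"
    unfolding \<eta>_def by (intro sums_mult geometric_sums) simp
  then have \<eta>sum: "(\<Sum>n. ennreal (q * \<eta> n)) = ennreal (e / 2)"
    using q \<eta> by (subst suminf_ennreal_eq) (auto intro: less_imp_le)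
  have "emeasure lborel W \<le> (\<Sum>n. emeasure lborel (T n))"
    unfolding W_def by (rule emeasure_subadditive_countably) (use T(1) in auto)
  also have "\<dots> \<le> (\<Sum>n. ennreal (q / u) * hausdorff_weight k (C n) + ennreal (q * \<eta> n))"
    by (intro suminf_le T summableI)
  also have "\<dots> = ennreal (q / u) * (\<Sum>n. hausdorff_weight k (C n)) + ennreal (e / 2)"
    by (subst suminf_add[symmetric]) (auto simp: \<eta>sum)
  also have "\<dots> \<le> ennreal (q / u) * ennreal \<epsilon> + ennreal (e / 2)"
    using C(4) by (intro add_right_mono mult_left_mono) auto
  also have "\<dots> = ennreal (q / u * \<epsilon> + e / 2)"
    using q u \<epsilon> e by (simp flip: ennreal_mult ennreal_plus)
  also have "q / u * \<epsilon> + e / 2 = e" using q u by (simp add: \<epsilon>_def)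
  finally have m: "emeasure lborel W \<le> ennreal e" .
  then have "W \<in> fmeasurable lborel"
    using W by (intro fmeasurableI) (auto simp: less_top[symmetric] top_unique)
  then have "W \<in> lmeasurable" "measure lebesgue W = measure lborel W"
    by (auto simp: lmeasurable_iff_integrable_on fmeasurable_def W)
  moreover have "measure lborel W \<le> e"
    unfolding measure_def using m e by (intro enn2real_leI) auto
  ultimately show "\<exists>T. tube v Z \<subseteq> T \<and> T \<in> lmeasurable \<and> measure lebesgue T \<le> e"
    using sub by auto
qed

section \<open>The graph of a mesh\<close>

lemma convex_cone_point_in:
  fixes K :: "'a::euclidean_space set"
  assumes "open K" "convex K" "c \<in> K" "y \<in> closure K" "y \<notin> K" "0 < s" "s < 1"
  shows "c + s *\<^sub>R (y - c) \<in> K"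
proof -
  have "open_segment c y \<subseteq> interior K"
    using assms by (intro in_interior_closure_convex_segment) (auto simp: interior_open)
  moreover have "c + s *\<^sub>R (y - c) \<in> open_segment c y"
    using assms by (auto simp: in_segment algebra_simps intro!: exI[of _ s])
  ultimately show ?thesis using \<open>open K\<close> by (auto simp: interior_open)
qed

text \<open>If \<open>c\<close> lay in the hyperplane, the segment from \<open>c\<close> to a
  relative interior point \<open>p\<close> of \<open>\<sigma>\<close> would stay in the hyperplane
  and so enter \<open>\<sigma>\<close> shortly before \<open>p\<close>, while it runs inside
  \<open>K\<close>, which is disjoint from \<open>\<sigma>\<close>.\<close>

lemma convex_off_hyperplane:
  fixes K :: "'a::euclidean_space set"
  assumes K: "open K" "convex K" "c \<in> K" and \<sigma>: "\<sigma> \<subseteq> closure K" "\<sigma> \<inter> K = {}"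
    and "convex \<sigma>" "\<sigma> \<noteq> {}" and hull: "affine hull \<sigma> = {x. a \<bullet> x = b}"
  shows "a \<bullet> c \<noteq> b"
proof
  assume c: "a \<bullet> c = b"
  obtain p where "p \<in> rel_interior \<sigma>"
    using rel_interior_eq_empty[OF \<open>convex \<sigma>\<close>] \<open>\<sigma> \<noteq> {}\<close> by blast
  then obtain e where p: "p \<in> \<sigma>" and e: "e > 0" "ball p e \<inter> affine hull \<sigma> \<subseteq> \<sigma>"
    unfolding mem_rel_interior_ball by blast
  have pK: "p \<in> closure K" "p \<notin> K" using p \<sigma> by auto
  have ap: "a \<bullet> p = b" using p hull hull_subset[of \<sigma> affine] by blast
  have "((\<lambda>s. c + s *\<^sub>R (p - c)) \<longlongrightarrow> c + 1 *\<^sub>R (p - c)) (at_left (1::real))"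
    by (intro tendsto_intros)
  then have "\<forall>\<^sub>F s in at_left 1. c + s *\<^sub>R (p - c) \<in> ball p e"
    by (intro topological_tendstoD) (use e in auto)
  moreover have "\<forall>\<^sub>F s in at_left (1::real). s \<in> {0<..<1}"
    by (rule eventually_at_left_real) simp
  ultimately have "\<forall>\<^sub>F s in at_left (1::real). c + s *\<^sub>R (p - c) \<in> ball p e \<and> s \<in> {0<..<1}"
    by (rule eventually_conj)
  then have "\<exists>s. c + s *\<^sub>R (p - c) \<in> ball p e \<and> s \<in> {0<..<1::real}"
    by (rule eventually_happens'[rotated]) simp
  then obtain s where s: "c + s *\<^sub>R (p - c) \<in> ball p e" "0 < s" "s < 1" by auto
  have "a \<bullet> (c + s *\<^sub>R (p - c)) = b" by (simp add: inner_add_right inner_diff_right c ap)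
  then have "c + s *\<^sub>R (p - c) \<in> \<sigma>" using s(1) e(2) hull by blast
  moreover have "c + s *\<^sub>R (p - c) \<in> K"
    by (rule convex_cone_point_in[OF K pK s(2,3)])
  ultimately show False using \<sigma>(2) by blast
qed

text \<open>Two cones with apices on the same side of the hyperplane and a common base meet near the
  relative interior of the base.\<close>

lemma convex_same_side_meet:
  fixes K L :: "'a::euclidean_space set"
  assumes K: "open K" "convex K" "c \<in> K" and L: "open L" "convex L" "d \<in> L"
    and \<sigma>: "\<sigma> \<subseteq> closure K" "\<sigma> \<subseteq> closure L" "\<sigma> \<inter> K = {}" "\<sigma> \<inter> L = {}"
    and "convex \<sigma>" "\<sigma> \<noteq> {}" and hull: "affine hull \<sigma> = {x. a \<bullet> x = b}"
    and side: "a \<bullet> c > b" "a \<bullet> d > b"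
  shows "K \<inter> L \<noteq> {}"
proof -
  obtain p where "p \<in> rel_interior \<sigma>"
    using rel_interior_eq_empty[OF \<open>convex \<sigma>\<close>] \<open>\<sigma> \<noteq> {}\<close> by blast
  then obtain e where p: "p \<in> \<sigma>" and e: "e > 0" "ball p e \<inter> affine hull \<sigma> \<subseteq> \<sigma>"
    unfolding mem_rel_interior_ball by blast
  have ap: "a \<bullet> p = b" using p hull hull_subset[of \<sigma> affine] by blast
  define \<alpha> where "\<alpha> = a \<bullet> c - b"
  define \<beta> where "\<beta> = a \<bullet> d - b"
  have pos: "\<alpha> > 0" "\<beta> > 0" using side by (auto simp: \<alpha>_def \<beta>_def)
  \<comment> \<open>\<open>q \<delta>\<close> lies on the segment from \<open>p\<close> to
    \<open>c\<close> at height \<open>\<delta> * \<alpha>\<close> over the hyperplane, and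
    \<open>y \<delta>\<close> is where the line from \<open>d\<close> through
    \<open>q \<delta>\<close> hits the hyperplane. Since \<open>y \<delta>\<close> tends to
    \<open>p\<close>, it lies in \<open>\<sigma>\<close> for small \<open>\<delta>\<close>, and then
    \<open>q \<delta>\<close> belongs to both cones.\<close>
  define q where "q \<delta> = p + \<delta> *\<^sub>R (c - p)" for \<delta>
  define y where "y \<delta> = d + (\<beta> / (\<beta> - \<delta> * \<alpha>)) *\<^sub>R (q \<delta> - d)" for \<delta>
  have "((\<lambda>\<delta>. d + (\<beta> / (\<beta> - \<delta> * \<alpha>)) *\<^sub>R (p + \<delta> *\<^sub>R (c - p) - d))
      \<longlongrightarrow> d + (\<beta> / (\<beta> - 0 * \<alpha>)) *\<^sub>R (p + 0 *\<^sub>R (c - p) - d)) (at_right 0)"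
    using pos by (intro tendsto_intros) auto
  then have "(y \<longlongrightarrow> p) (at_right 0)" using pos by (simp add: y_def[abs_def] q_def)
  then have "\<forall>\<^sub>F \<delta> in at_right 0. y \<delta> \<in> ball p e"
    by (intro topological_tendstoD) (use e in auto)
  moreover have "\<forall>\<^sub>F \<delta> in at_right (0::real). \<delta> \<in> {0<..<min 1 (\<beta> / \<alpha>)}"
    by (rule eventually_at_right_real) (use pos in simp)
  ultimately have "\<forall>\<^sub>F \<delta> in at_right (0::real). y \<delta> \<in> ball p e \<and> \<delta> \<in> {0<..<min 1 (\<beta> / \<alpha>)}"
    by (rule eventually_conj)
  then have "\<exists>\<delta>. y \<delta> \<in> ball p e \<and> \<delta> \<in> {0<..<min 1 (\<beta> / \<alpha>)}"
    by (rule eventually_happens'[rotated]) simp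
  then obtain \<delta> where \<delta>: "y \<delta> \<in> ball p e" "0 < \<delta>" "\<delta> < 1" "\<delta> < \<beta> / \<alpha>" by auto
  have gap: "0 < \<delta> * \<alpha>" "0 < \<beta> - \<delta> * \<alpha>" using \<delta> pos by (auto simp: field_simps)
  have "a \<bullet> (q \<delta> - d) = \<delta> * \<alpha> - \<beta>"
    by (simp add: q_def \<alpha>_def \<beta>_def inner_add_right inner_diff_right ap algebra_simps)
  then have "a \<bullet> y \<delta> = a \<bullet> d + (\<beta> / (\<beta> - \<delta> * \<alpha>)) * (\<delta> * \<alpha> - \<beta>)"
    by (simp add: y_def inner_add_right)
  also have "(\<beta> / (\<beta> - \<delta> * \<alpha>)) * (\<delta> * \<alpha> - \<beta>) = - \<beta>"
    using gap by (simp add: field_simps)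
  finally have "a \<bullet> y \<delta> = b" by (simp add: \<beta>_def)
  then have y\<sigma>: "y \<delta> \<in> \<sigma>" using \<delta>(1) e(2) hull by blast
  have "q \<delta> = c + (1 - \<delta>) *\<^sub>R (p - c)" by (simp add: q_def algebra_simps)
  also have "\<dots> \<in> K"
    by (rule convex_cone_point_in[OF K]) (use p \<sigma> \<delta> in auto)
  finally have "q \<delta> \<in> K" .
  moreover have "q \<delta> \<in> L"
  proof -
    define s where "s = (\<beta> - \<delta> * \<alpha>) / \<beta>"
    have s: "0 < s" "s < 1" using gap pos by (auto simp: s_def)
    have "q \<delta> = d + s *\<^sub>R (y \<delta> - d)"
      using gap pos by (simp add: y_def s_def)
    also have "\<dots> \<in> L"
      by (rule convex_cone_point_in[OF L _ _ s]) (use y\<sigma> \<sigma> in auto)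
    finally show ?thesis .
  qed
  ultimately show ?thesis by blast
qed

locale mesh_on =
  fixes \<Omega> :: "'a::euclidean_space set" and M :: "'a mesh"
  assumes open_\<Omega>: "open \<Omega>" and connected_\<Omega>: "connected \<Omega>" and bounded_\<Omega>: "bounded \<Omega>"
    and adm: "admissible_mesh \<Omega> M"
begin

lemma
  shows finite_cells: "finite (cells M)"
    and finite_faces: "finite (faces M)"
    and closure_cells: "(\<Union>K\<in>cells M. closure K) = closure \<Omega>"
  using adm unfolding admissible_mesh_def by simp_all

lemma
  assumes "K \<in> cells M"
  shows cell_nonempty: "K \<noteq> {}" and open_cell: "open K" and convex_cell: "convex K"
    and cell_subset: "K \<subseteq> \<Omega>" and center_in_cell: "center M K \<in> K"
    and cell_faces_subset: "cell_faces M K \<subseteq> faces M"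
    and frontier_cell: "frontier K = \<Union>(cell_faces M K)"
  using adm assms unfolding admissible_mesh_def by simp_all

lemma cells_disjoint: "K \<in> cells M \<Longrightarrow> L \<in> cells M \<Longrightarrow> K \<noteq> L \<Longrightarrow> K \<inter> L = {}"
  using adm unfolding admissible_mesh_def by simp

lemma face_props:
  assumes "\<sigma> \<in> faces M"
  shows "\<exists>a b. a \<noteq> 0 \<and> \<sigma> \<subseteq> {x. a \<bullet> x = b}" "face_measure \<sigma> > 0" "surface \<sigma> \<noteq> 0"
proof -
  show "\<exists>a b. a \<noteq> 0 \<and> \<sigma> \<subseteq> {x. a \<bullet> x = b}" and *: "face_measure \<sigma> > 0"
    using adm assms unfolding admissible_mesh_def by simp_all
  show "surface \<sigma> \<noteq> 0" using * by (auto simp: face_measure_def)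
qed

lemma faces_meet_null: "\<lbrakk>\<sigma> \<in> faces M; \<sigma>' \<in> faces M; \<sigma> \<noteq> \<sigma>'\<rbrakk> \<Longrightarrow> surface (\<sigma> \<inter> \<sigma>') = 0"
  using adm unfolding admissible_mesh_def by simp

lemma cells_contact:
  "\<lbrakk>K \<in> cells M; L \<in> cells M; K \<noteq> L\<rbrakk> \<Longrightarrow>
    closure K \<inter> closure L \<in> faces M \<or> surface (closure K \<inter> closure L) = 0"
  using adm unfolding admissible_mesh_def by simp

lemma bounded_cell: "K \<in> cells M \<Longrightarrow> bounded K"
  using bounded_\<Omega> cell_subset bounded_subset by blast

lemma cell_lmeasurable: "K \<in> cells M \<Longrightarrow> K \<in> lmeasurable"
  using bounded_cell open_cell by (intro lmeasurable_open)

lemma measure_cell_pos: "K \<in> cells M \<Longrightarrow> measure lebesgue K > 0"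
  using open_not_negligible[OF open_cell cell_nonempty] cell_lmeasurable
  by (metis negligible_iff_measure measure_nonneg order_le_less)

lemma cell_closure_disjoint:
  assumes "K \<in> cells M" "L \<in> cells M" "K \<noteq> L"
  shows "K \<inter> closure L = {}"
  using cells_disjoint[OF assms] open_Int_closure_eq_empty[OF open_cell[OF assms(1)]] by blast

text \<open>Makes the \<open>THE\<close> in \<open>neighbour\<close> meaningful. By pigeonhole, of
  three cells at \<open>\<sigma>\<close> two have their centres on the same side of its hyperplane,
  and these cells would intersect.\<close>

lemma shared_face_unique:
  assumes KL: "shared_face M K L \<sigma>" and KL': "shared_face M K L' \<sigma>"
  shows "L = L'"
proof (rule ccontr)
  assume "L \<noteq> L'"
  have cells: "K \<in> cells M" "L \<in> cells M" "L' \<in> cells M" and "K \<noteq> L" "K \<noteq> L'"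
    and \<sigma>F: "\<sigma> \<in> faces M"
    and \<sigma>eq: "\<sigma> = closure K \<inter> closure L" "\<sigma> = closure K \<inter> closure L'"
    using KL KL' by (auto simp: shared_face_def)
  obtain a b where "a \<noteq> 0" and H: "\<sigma> \<subseteq> {x. a \<bullet> x = b}" using face_props(1)[OF \<sigma>F] by blast
  have convex: "convex \<sigma>"
    unfolding \<sigma>eq(1) using cells by (intro convex_Int convex_closure convex_cell)
  have "bounded \<sigma>"
    unfolding \<sigma>eq(1) using cells bounded_cell by (simp add: bounded_Int bounded_closure)
  \<comment> \<open>A bounded set of lower dimension has surface measure 0, so
    \<open>\<sigma>\<close> spans its whole hyperplane affinely.\<close>
  then have "\<not> aff_dim \<sigma> < int (DIM('a) - 1)"
    using hausdorff_lowdim[of \<sigma> "DIM('a) - 1"] face_props(3)[OF \<sigma>F] by blast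
  then have "aff_dim \<sigma> \<ge> int DIM('a) - 1" by simp
  moreover have "aff_dim \<sigma> \<le> aff_dim {x. a \<bullet> x = b}" using H by (rule aff_dim_subset)
  ultimately have dim: "aff_dim (affine hull \<sigma>) = aff_dim {x. a \<bullet> x = b}"
    using \<open>a \<noteq> 0\<close> by simp
  have ne: "\<sigma> \<noteq> {}" using face_props(3)[OF \<sigma>F] hausdorff_empty by metis
  have hull: "affine hull \<sigma> = {x. a \<bullet> x = b}"
    using dim ne H by (intro affine_dim_equal) (auto simp: affine_hyperplane hull_minimal)
  \<comment> \<open>\<open>convex_same_side_meet\<close> treats the side above \<open>b\<close>;
    negating the normal reaches the other side.\<close>
  then have hull': "affine hull \<sigma> = {x. (- a) \<bullet> x = - b}" by simp
  have inc: "\<sigma> \<subseteq> closure J" "\<sigma> \<inter> J = {}" if "J \<in> {K, L, L'}" for J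
    using that \<sigma>eq cell_closure_disjoint[of J] cells \<open>K \<noteq> L\<close> \<open>K \<noteq> L'\<close> by blast+
  have meet: "\<not> (a \<bullet> center M J > b \<and> a \<bullet> center M J' > b)"
    "\<not> (a \<bullet> center M J < b \<and> a \<bullet> center M J' < b)"
    if J: "J \<in> {K, L, L'}" "J' \<in> {K, L, L'}" "J \<noteq> J'" for J J'
  proof -
    have JC: "J \<in> cells M" "J' \<in> cells M" using J cells by auto
    have "J \<inter> J' = {}" using cells_disjoint JC J by blast
    then show "\<not> (a \<bullet> center M J > b \<and> a \<bullet> center M J' > b)"
      "\<not> (a \<bullet> center M J < b \<and> a \<bullet> center M J' < b)"
      using convex_same_side_meet[OF open_cell[OF JC(1)] convex_cell[OF JC(1)] center_in_cell[OF JC(1)]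
          open_cell[OF JC(2)] convex_cell[OF JC(2)] center_in_cell[OF JC(2)]
          inc(1)[OF J(1)] inc(1)[OF J(2)] inc(2)[OF J(1)] inc(2)[OF J(2)] convex ne]
        hull hull' by (metis inner_minus_left neg_less_iff_less)+
  qed
  have off: "a \<bullet> center M J \<noteq> b" if J: "J \<in> {K, L, L'}" for J
  proof -
    have JC: "J \<in> cells M" using J cells by auto
    show ?thesis
      by (rule convex_off_hyperplane[OF open_cell[OF JC] convex_cell[OF JC] center_in_cell[OF JC]
            inc[OF J] convex ne hull])
  qed
  have tri: "K \<in> {K, L, L'}" "L \<in> {K, L, L'}" "L' \<in> {K, L, L'}" by simp_all
  show False
    using meet[OF tri(1,2) \<open>K \<noteq> L\<close>] meet[OF tri(1,3) \<open>K \<noteq> L'\<close>] meet[OF tri(2,3) \<open>L \<noteq> L'\<close>]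
      off[OF tri(1)] off[OF tri(2)] off[OF tri(3)] by linarith
qed

lemma neighbour_eq:
  assumes "shared_face M K L \<sigma>"
  shows "neighbour M K \<sigma> = L"
  unfolding neighbour_def by (rule the_equality[where P = "\<lambda>L. shared_face M K L \<sigma>", OF assms])
     (rule shared_face_unique[OF _ assms])

text \<open>Otherwise \<open>\<sigma>\<close>, a subset of \<open>frontier K\<close>, would be
  covered by its null intersections with the finitely many faces of \<open>K\<close>, against its
  positive measure.\<close>

lemma shared_face_in_cell_faces:
  assumes "shared_face M K L \<sigma>"
  shows "\<sigma> \<in> cell_faces M K"
proof (rule ccontr)
  assume notin: "\<sigma> \<notin> cell_faces M K"
  have KL: "K \<in> cells M" "L \<in> cells M" "K \<noteq> L" "\<sigma> \<in> faces M" "\<sigma> = closure K \<inter> closure L"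
    using assms by (auto simp: shared_face_def)
  have "\<sigma> \<subseteq> frontier K"
    using cell_closure_disjoint[OF KL(1,2,3)] open_cell[OF KL(1)] KL(5)
    by (auto simp: frontier_def interior_open)
  then have "\<sigma> \<subseteq> (\<Union>\<sigma>'\<in>cell_faces M K. \<sigma> \<inter> \<sigma>')"
    using frontier_cell[OF KL(1)] by blast
  then have "surface \<sigma> \<le> surface (\<Union>\<sigma>'\<in>cell_faces M K. \<sigma> \<inter> \<sigma>')"
    by (rule hausdorff_mono)
  also have "\<dots> = 0"
  proof (rule hausdorff_null_UN)
    show "finite (cell_faces M K)"
      using finite_subset[OF cell_faces_subset[OF KL(1)] finite_faces] .
    show "surface (\<sigma> \<inter> \<sigma>') = 0" if "\<sigma>' \<in> cell_faces M K" for \<sigma>'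
      using that notin cell_faces_subset[OF KL(1)] KL(4) by (intro faces_meet_null) auto
  qed
  finally show False using face_props(3)[OF KL(4)] by simp
qed

text \<open>The transmissibility as a function of the pair of cells, which makes its symmetry
  visible. It is 0 for \<open>K = L\<close>, since \<open>shared_face\<close> demands distinct
  cells.\<close>

definition coupling :: "'a set \<Rightarrow> 'a set \<Rightarrow> real" where
  "coupling K L = (if shared_face M K L (closure K \<inter> closure L)
     then face_measure (closure K \<inter> closure L) / norm (center M K - center M L) else 0)"

lemma coupling_commute: "coupling K L = coupling L K"
proof -
  have "shared_face M K L (closure K \<inter> closure L) \<longleftrightarrow> shared_face M L K (closure L \<inter> closure K)"
    by (auto simp: shared_face_def Int_commute)
  then show ?thesis by (simp add: coupling_def Int_commute norm_minus_commute)
qed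

lemma coupling_nonneg: "coupling K L \<ge> 0"
  by (simp add: coupling_def face_measure_def)

lemma coupling_pos:
  assumes "K \<in> cells M" "L \<in> cells M" "K \<noteq> L" "surface (closure K \<inter> closure L) \<noteq> 0"
  shows "coupling K L > 0"
proof -
  have F: "closure K \<inter> closure L \<in> faces M" using cells_contact assms by blast
  have "center M K \<noteq> center M L"
    using center_in_cell assms cells_disjoint[OF assms(1,2,3)] by (metis disjoint_iff)
  then show ?thesis
    using F assms face_props(2)[OF F] by (simp add: coupling_def shared_face_def)
qed

text \<open>If two cells meeting a ball in \<open>\<Omega>\<close> belonged to different classes, the interface between the
  classes would cross all segments from a small ball in one cell to a translate of it in the other,
  so a tube over the interface would have positive volume.\<close>

lemma cells_connected:
  assumes "S \<subseteq> cells M" "S \<noteq> {}"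
    and closed: "\<And>K L. \<lbrakk>K \<in> S; L \<in> cells M; coupling K L > 0\<rbrakk> \<Longrightarrow> L \<in> S"
  shows "S = cells M"
proof (rule ccontr)
  assume "S \<noteq> cells M"
  define S' where "S' = cells M - S"
  have "S' \<noteq> {}" using \<open>S \<noteq> cells M\<close> assms(1) by (auto simp: S'_def)
  have fin: "finite S" "finite S'" using finite_cells assms(1) finite_subset by (auto simp: S'_def)
  have sub: "S' \<subseteq> cells M" by (auto simp: S'_def)
  define P where "P = (\<Union>K\<in>S. closure K)"
  define Q where "Q = (\<Union>K\<in>S'. closure K)"
  have clo: "closed P" "closed Q" using fin by (auto simp: P_def Q_def)
  have "P \<union> Q = closure \<Omega>"
    unfolding P_def Q_def closure_cells[symmetric] using assms(1) by (auto simp: S'_def)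
  then have cover: "\<Omega> \<subseteq> P \<union> Q" using closure_subset by blast
  define Z where "Z = P \<inter> Q"
  \<comment> \<open>A cell of \<open>S\<close> and a cell outside \<open>S\<close> with non-null
    contact would be coupled by \<open>coupling_pos\<close>, and \<open>closed\<close> would draw
    the second into \<open>S\<close>.\<close>
  have "surface Z = 0"
  proof -
    have "Z = (\<Union>(K, L)\<in>S \<times> S'. closure K \<inter> closure L)" by (auto simp: Z_def P_def Q_def)
    also have "surface \<dots> = 0"
    proof (rule hausdorff_null_UN)
      show "finite (S \<times> S')" using fin by simp
      fix KL assume "KL \<in> S \<times> S'"
      then obtain K L where KL: "KL = (K, L)" "K \<in> S" "L \<in> cells M" "L \<notin> S"
        by (auto simp: S'_def)
      then show "surface (case KL of (K, L) \<Rightarrow> closure K \<inter> closure L) = 0"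
        using coupling_pos[of K L] closed[of K L] assms(1) by auto
    qed
    finally show ?thesis .
  qed
  have "P \<inter> \<Omega> \<noteq> {}" "Q \<inter> \<Omega> \<noteq> {}"
  proof -
    have "C \<subseteq> (\<Union>K\<in>T. closure K) \<inter> \<Omega>" if "C \<in> T" "T \<subseteq> cells M" for C T
      using that cell_subset closure_subset by blast
    then show "P \<inter> \<Omega> \<noteq> {}" "Q \<inter> \<Omega> \<noteq> {}"
      using \<open>S \<noteq> {}\<close> \<open>S' \<noteq> {}\<close> assms(1) sub cell_nonempty unfolding P_def Q_def
      by (metis subset_empty subsetD all_not_in_conv)+
  qed
  then have "P \<inter> Q \<inter> \<Omega> \<noteq> {}"
    using connected_\<Omega> cover clo unfolding connected_closed by blast
  then obtain x where x: "x \<in> P" "x \<in> Q" "x \<in> \<Omega>" by blast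
  obtain r where r: "r > 0" "ball x r \<subseteq> \<Omega>" using open_\<Omega> x(3) open_contains_ball by blast
  \<comment> \<open>\<open>x\<close> is only known to lie in closures of cells; the tube argument
    needs whole balls inside a cell of each class.\<close>
  have pt: "\<exists>K\<in>T. \<exists>y \<rho>. \<rho> > 0 \<and> ball y \<rho> \<subseteq> K \<inter> ball x r"
    if xT: "x \<in> (\<Union>K\<in>T. closure K)" and T: "T \<subseteq> cells M" for T
  proof -
    obtain K where K: "K \<in> T" "x \<in> closure K" using xT by blast
    then have "K \<inter> ball x r \<noteq> {}"
      using open_Int_closure_eq_empty[of "ball x r" K] r(1) by (auto simp: Int_commute)
    then obtain y where "y \<in> K \<inter> ball x r" by blast
    moreover have "open (K \<inter> ball x r)" using K(1) T open_cell by (intro open_Int) auto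
    ultimately show ?thesis using K(1) open_contains_ball by (metis (no_types))
  qed
  obtain K y \<rho>1 where K: "K \<in> S" "\<rho>1 > 0" "ball y \<rho>1 \<subseteq> K \<inter> ball x r"
    using pt[of S] x(1) assms(1) by (auto simp: P_def)
  obtain L y' \<rho>2 where L: "L \<in> S'" "\<rho>2 > 0" "ball y' \<rho>2 \<subseteq> L \<inter> ball x r"
    using pt[of S'] x(2) sub by (auto simp: Q_def)
  define v where "v = y' - y"
  define \<rho> where "\<rho> = min \<rho>1 \<rho>2"
  have "ball y \<rho> \<subseteq> tube (- v) Z"
  proof
    fix w assume w: "w \<in> ball y \<rho>"
    have wK: "w \<in> K \<inter> ball x r" using w K by (auto simp: \<rho>_def)
    have "dist y' (w + v) = dist y w" by (simp add: v_def dist_norm algebra_simps)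
    then have "w + v \<in> ball y' \<rho>2" using w by (simp add: \<rho>_def)
    then have wL: "w + v \<in> L \<inter> ball x r" using L(3) by blast
    have seg: "closed_segment w (w + v) \<subseteq> ball x r"
      using wK wL by (intro closed_segment_subset) auto
    have "P \<inter> Q \<inter> closed_segment w (w + v) \<noteq> {}"
    proof -
      have "w \<in> P" "w + v \<in> Q" using wK wL K L closure_subset by (auto simp: P_def Q_def)
      then have "P \<inter> closed_segment w (w + v) \<noteq> {}" "Q \<inter> closed_segment w (w + v) \<noteq> {}" by auto
      moreover have "closed_segment w (w + v) \<subseteq> P \<union> Q" using seg r(2) cover by blast
      ultimately show ?thesis
        using connected_segment[of w "w + v"] clo unfolding connected_closed by blast
    qed
    then obtain z where z: "z \<in> Z" "z \<in> closed_segment w (w + v)" by (auto simp: Z_def)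
    then obtain s where s: "0 \<le> s" "s \<le> 1" "z = (1 - s) *\<^sub>R w + s *\<^sub>R (w + v)"
      by (auto simp: in_segment)
    then have "w = z + s *\<^sub>R (- v)" by (simp add: algebra_simps)
    then show "w \<in> tube (- v) Z" using z s by (auto simp: tube_def)
  qed
  then have "negligible (ball y \<rho>)"
    using negligible_tube[OF \<open>surface Z = 0\<close>] negligible_subset by blast
  moreover have "\<rho> > 0" using K L by (simp add: \<rho>_def)
  ultimately show False using open_not_negligible[of "ball y \<rho>"] by simp
qed

sublocale weighted_graph "cells M" "measure lebesgue" coupling
  by unfold_locales
     (use finite_cells measure_cell_pos coupling_nonneg coupling_commute cells_connected in blast)+

section \<open>The scheme on the mesh as the scheme on its graph\<close>

lemma flux_shared_face:
  assumes "shared_face M K L \<sigma>"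
  shows "flux M A astar U i K \<sigma> = coupling K L * pair_flux A astar (U K) (U L) i"
proof -
  have ex: "\<exists>L. shared_face M K L \<sigma>" using assms by blast
  have "\<sigma> = closure K \<inter> closure L" using assms by (simp add: shared_face_def)
  then have "transmissibility M K \<sigma> = coupling K L"
    using assms ex neighbour_eq[OF assms]
    by (simp add: transmissibility_def face_dist_def coupling_def)
  then show ?thesis
    using ex by (simp add: flux_def pair_flux_def face_diff_def face_value_def mirror_value_def
        component_def neighbour_eq[OF assms] right_diff_distrib mult_ac)
qed

lemma flux_not_shared_face:
  assumes "\<not> (\<exists>L. shared_face M K L \<sigma>)"
  shows "flux M A astar U i K \<sigma> = 0"
  using assms by (simp add: flux_def face_diff_def mirror_value_def)

text \<open>Faces that are not shared carry no flux, and the shared faces of \<open>K\<close>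
  correspond one to one to its neighbours: \<open>shared_face_unique\<close> gives injectivity, and
  \<open>shared_face_in_cell_faces\<close> ensures that no neighbour is missed.\<close>

lemma sum_flux:
  assumes K: "K \<in> cells M"
  shows "(\<Sum>\<sigma>\<in>cell_faces M K. flux M A astar U i K \<sigma>)
       = (\<Sum>L\<in>cells M. coupling K L * pair_flux A astar (U K) (U L) i)"
proof -
  define \<N> where "\<N> = {L \<in> cells M. shared_face M K L (closure K \<inter> closure L)}"
  define \<F> where "\<F> = {\<sigma> \<in> cell_faces M K. \<exists>L. shared_face M K L \<sigma>}"
  have bij: "bij_betw (\<lambda>L. closure K \<inter> closure L) \<N> \<F>"
    unfolding bij_betw_def
  proof
    show "inj_on (\<lambda>L. closure K \<inter> closure L) \<N>"
    proof (rule inj_onI)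
      fix L L' assume "L \<in> \<N>" "L' \<in> \<N>" and eq: "closure K \<inter> closure L = closure K \<inter> closure L'"
      then have "shared_face M K L (closure K \<inter> closure L)" "shared_face M K L' (closure K \<inter> closure L')"
        unfolding \<N>_def by blast+
      then show "L = L'" using eq shared_face_unique by metis
    qed
    show "(\<lambda>L. closure K \<inter> closure L) ` \<N> = \<F>"
    proof (intro equalityI subsetI)
      fix \<sigma> assume "\<sigma> \<in> (\<lambda>L. closure K \<inter> closure L) ` \<N>"
      then obtain L where "shared_face M K L \<sigma>" by (auto simp: \<N>_def)
      then show "\<sigma> \<in> \<F>" using shared_face_in_cell_faces unfolding \<F>_def by blast
    next
      fix \<sigma> assume "\<sigma> \<in> \<F>"
      then obtain L where L: "shared_face M K L \<sigma>" by (auto simp: \<F>_def)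
      then have "L \<in> cells M" "\<sigma> = closure K \<inter> closure L" by (auto simp: shared_face_def)
      then show "\<sigma> \<in> (\<lambda>L. closure K \<inter> closure L) ` \<N>" using L by (auto simp: \<N>_def)
    qed
  qed
  have "(\<Sum>\<sigma>\<in>cell_faces M K. flux M A astar U i K \<sigma>) = (\<Sum>\<sigma>\<in>\<F>. flux M A astar U i K \<sigma>)"
    by (rule sum.mono_neutral_right)
       (use finite_subset[OF cell_faces_subset[OF K] finite_faces] in
         \<open>auto simp: \<F>_def intro!: flux_not_shared_face\<close>)
  also have "\<dots> = (\<Sum>L\<in>\<N>. flux M A astar U i K (closure K \<inter> closure L))"
    by (rule sum.reindex_bij_betw[OF bij, symmetric])
  also have "\<dots> = (\<Sum>L\<in>\<N>. coupling K L * pair_flux A astar (U K) (U L) i)"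
    by (intro sum.cong refl flux_shared_face) (simp add: \<N>_def)
  also have "\<dots> = (\<Sum>L\<in>cells M. coupling K L * pair_flux A astar (U K) (U L) i)"
    by (rule sum.mono_neutral_left) (auto simp: \<N>_def coupling_def finite_cells)
  finally show ?thesis .
qed

lemma solves_scheme_iff:
  "solves_scheme M A astar dt V U \<longleftrightarrow> step_solution A astar dt V U"
  unfolding solves_scheme_def step_solution_def by (simp add: sum_flux)

end

section \<open>Cell averages and the time steps\<close>

context mesh_on
begin

lemma lebesgue_on_\<Omega>: "\<Omega> \<inter> space lebesgue \<in> sets lebesgue"
  using open_\<Omega> by simp

text \<open>The closures of the cells cover \<open>\<Omega>\<close>, and the frontiers of convex
  sets are negligible.\<close>

lemma cells_cover_AE: "AE x in lebesgue. x \<in> \<Omega> \<longrightarrow> x \<in> \<Union>(cells M)"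
proof -
  have "negligible (\<Union>K\<in>cells M. frontier K)"
    using finite_cells convex_cell negligible_convex_frontier by (intro negligible_Union) auto
  then have null: "(\<Union>K\<in>cells M. frontier K) \<in> null_sets lebesgue"
    by (simp add: negligible_iff_null_sets)
  have "x \<in> \<Union>(cells M)" if "x \<in> \<Omega>" "x \<notin> (\<Union>K\<in>cells M. frontier K)" for x
  proof -
    have "x \<in> (\<Union>K\<in>cells M. closure K)" unfolding closure_cells using that(1) closure_subset by blast
    then obtain K where K: "K \<in> cells M" "x \<in> closure K" by blast
    then have "x \<in> interior K" using that(2) by (auto simp: frontier_def)
    then show ?thesis using K(1) interior_subset by blast
  qed
  then show ?thesis using AE_not_in[OF null] by (elim eventually_mono) auto
qed

context
  fixes u0 :: "'a \<Rightarrow> real ^ 'n::finite"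
  assumes meas: "u0 \<in> borel_measurable (lebesgue_on \<Omega>)"
    and simplex: "AE x in lebesgue_on \<Omega>. u0 x \<in> simplex_set"
begin

lemma simplex_AE: "AE x in lebesgue. x \<in> \<Omega> \<longrightarrow> u0 x \<in> simplex_set"
  using simplex by (simp only: AE_restrict_space_iff[OF lebesgue_on_\<Omega>])

text \<open>Integrals over \<open>\<Omega>\<close> and over the cells are written over
  \<open>lebesgue\<close> with indicators, so that they can be compared and added on one measure
  space.\<close>

lemma integrable_density:
  "integrable lebesgue (\<lambda>x. indicat_real \<Omega> x *\<^sub>R (u0 x $ i))"
proof -
  have fin: "finite_measure (lebesgue_on \<Omega>)"
    by (rule finite_measure_lebesgue_on) (rule lmeasurable_open[OF bounded_\<Omega> open_\<Omega>])
  have "integrable (lebesgue_on \<Omega>) (\<lambda>x. u0 x $ i)"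
  proof (rule finite_measure.integrable_const_bound[OF fin, where B = 1])
    show "AE x in lebesgue_on \<Omega>. norm (u0 x $ i) \<le> 1"
    proof (rule eventually_mono[OF simplex])
      fix x assume u: "u0 x \<in> simplex_set"
      then have "u0 x $ i \<le> (\<Sum>i\<in>UNIV. u0 x $ i)"
        by (intro member_le_sum) (auto simp: simplex_set_def)
      then show "norm (u0 x $ i) \<le> 1" using u by (simp add: simplex_set_def)
    qed
    show "(\<lambda>x. u0 x $ i) \<in> borel_measurable (lebesgue_on \<Omega>)"
      using meas by (rule borel_measurable_continuous_on[rotated]) (intro continuous_intros)
  qed
  then show ?thesis
    by (simp only: integrable_restrict_space[OF lebesgue_on_\<Omega>])
qed

lemma integrable_density_cell:
  assumes "K \<in> cells M"
  shows "integrable lebesgue (\<lambda>x. indicat_real K x *\<^sub>R (u0 x $ i))"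
proof -
  have "integrable lebesgue (\<lambda>x. indicat_real K x *\<^sub>R (indicat_real \<Omega> x *\<^sub>R (u0 x $ i)))"
    using cell_lmeasurable[OF assms] by (intro integrable_mult_indicator integrable_density) auto
  moreover have "indicat_real K x *\<^sub>R (indicat_real \<Omega> x *\<^sub>R (u0 x $ i)) = indicat_real K x *\<^sub>R (u0 x $ i)" for x
    using cell_subset[OF assms] by (auto simp: indicator_def)
  ultimately show ?thesis by (simp only:)
qed

lemma cell_average_mass:
  assumes "K \<in> cells M"
  shows "measure lebesgue K * cell_average u0 K $ i = (LINT x|lebesgue. indicat_real K x *\<^sub>R (u0 x $ i))"
proof -
  have "(LINT x|lebesgue_on K. u0 x $ i) = (LINT x|lebesgue. indicat_real K x *\<^sub>R (u0 x $ i))"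
    using cell_lmeasurable[OF assms] by (intro integral_restrict_space) auto
  then show ?thesis using measure_cell_pos[OF assms] by (simp add: cell_average_def)
qed

text \<open>The indicators of the disjoint cells sum to the indicator of \<open>\<Omega>\<close>
  almost everywhere.\<close>

lemma cell_average_total_mass:
  "(\<Sum>K\<in>cells M. measure lebesgue K * cell_average u0 K $ i) = (LINT x|lebesgue_on \<Omega>. u0 x $ i)"
proof -
  have "(\<Sum>K\<in>cells M. measure lebesgue K * cell_average u0 K $ i)
      = (\<Sum>K\<in>cells M. (LINT x|lebesgue. indicat_real K x *\<^sub>R (u0 x $ i)))"
    by (intro sum.cong refl cell_average_mass)
  also have "\<dots> = (LINT x|lebesgue. (\<Sum>K\<in>cells M. indicat_real K x *\<^sub>R (u0 x $ i)))"
    by (intro Bochner_Integration.integral_sum[symmetric] integrable_density_cell)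
  also have "\<dots> = (LINT x|lebesgue. indicat_real \<Omega> x *\<^sub>R (u0 x $ i))"
  proof (rule integral_cong_AE)
    show "(\<lambda>x. \<Sum>K\<in>cells M. indicat_real K x *\<^sub>R (u0 x $ i)) \<in> borel_measurable lebesgue"
      using integrable_density_cell by (intro borel_measurable_sum) auto
    show "(\<lambda>x. indicat_real \<Omega> x *\<^sub>R (u0 x $ i)) \<in> borel_measurable lebesgue"
      using integrable_density by auto
    show "AE x in lebesgue. (\<Sum>K\<in>cells M. indicat_real K x *\<^sub>R (u0 x $ i)) = indicat_real \<Omega> x *\<^sub>R (u0 x $ i)"
    proof (rule eventually_mono[OF cells_cover_AE])
      fix x assume x: "x \<in> \<Omega> \<longrightarrow> x \<in> \<Union>(cells M)"
      show "(\<Sum>K\<in>cells M. indicat_real K x *\<^sub>R (u0 x $ i)) = indicat_real \<Omega> x *\<^sub>R (u0 x $ i)"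
      proof (cases "x \<in> \<Omega>")
        case True
        then obtain K0 where K0: "K0 \<in> cells M" "x \<in> K0" using x by blast
        have "(\<Sum>K\<in>cells M. indicat_real K x *\<^sub>R (u0 x $ i))
            = (\<Sum>K\<in>cells M. if K = K0 then u0 x $ i else 0)"
        proof (rule sum.cong[OF refl])
          fix K assume "K \<in> cells M"
          then have "x \<in> K \<longleftrightarrow> K = K0" using K0 cells_disjoint by blast
          then show "indicat_real K x *\<^sub>R (u0 x $ i) = (if K = K0 then u0 x $ i else 0)"
            by (simp add: indicator_def)
        qed
        then show ?thesis using K0 finite_cells True by simp
      next
        case False
        then have "x \<notin> K" if "K \<in> cells M" for K using cell_subset[OF that] by blast
        then show ?thesis using False by simp
      qed
    qed
  qed
  also have "\<dots> = (LINT x|lebesgue_on \<Omega>. u0 x $ i)"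
    using integral_restrict_space[OF lebesgue_on_\<Omega>, of "\<lambda>x. u0 x $ i"] by simp
  finally show ?thesis .
qed

text \<open>Nonnegativity and unit sum are linear constraints, so averaging preserves them.\<close>

lemma cell_average_simplex:
  assumes K: "K \<in> cells M"
  shows "cell_average u0 K \<in> simplex_set"
proof -
  have m: "measure lebesgue K > 0" by (rule measure_cell_pos[OF K])
  have "0 \<le> cell_average u0 K $ i" for i
  proof -
    have "0 \<le> (LINT x|lebesgue. indicat_real K x *\<^sub>R (u0 x $ i))"
    proof (rule integral_nonneg_AE, rule eventually_mono[OF simplex_AE])
      show "0 \<le> indicat_real K x *\<^sub>R (u0 x $ i)" if "x \<in> \<Omega> \<longrightarrow> u0 x \<in> simplex_set" for x
        using that cell_subset[OF K] by (auto simp: indicator_def simplex_set_def)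
    qed
    then have "0 \<le> measure lebesgue K * cell_average u0 K $ i"
      by (simp only: cell_average_mass[OF K])
    then show ?thesis using m by (simp add: zero_le_mult_iff)
  qed
  moreover have "(\<Sum>i\<in>UNIV. cell_average u0 K $ i) = 1"
  proof -
    have "measure lebesgue K * (\<Sum>i\<in>UNIV. cell_average u0 K $ i)
        = (LINT x|lebesgue. (\<Sum>i\<in>UNIV. indicat_real K x *\<^sub>R (u0 x $ i)))"
      unfolding sum_distrib_left cell_average_mass[OF K]
      by (rule Bochner_Integration.integral_sum[symmetric]) (rule integrable_density_cell[OF K])
    also have "\<dots> = (LINT x|lebesgue. indicat_real K x)"
    proof (rule integral_cong_AE)
      show "(\<lambda>x. \<Sum>i\<in>UNIV. indicat_real K x *\<^sub>R (u0 x $ i)) \<in> borel_measurable lebesgue"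
        using integrable_density_cell[OF K] by (intro borel_measurable_sum) auto
      show "indicat_real K \<in> borel_measurable lebesgue"
        using cell_lmeasurable[OF K] by auto
      show "AE x in lebesgue. (\<Sum>i\<in>UNIV. indicat_real K x *\<^sub>R (u0 x $ i)) = indicat_real K x"
      proof (rule eventually_mono[OF simplex_AE])
        show "(\<Sum>i\<in>UNIV. indicat_real K x *\<^sub>R (u0 x $ i)) = indicat_real K x"
          if "x \<in> \<Omega> \<longrightarrow> u0 x \<in> simplex_set" for x
          using that cell_subset[OF K] by (auto simp: indicator_def simplex_set_def)
      qed
    qed
    also have "\<dots> = measure lebesgue K" using cell_lmeasurable[OF K] by simp
    finally show ?thesis using m by simp
  qed
  ultimately show ?thesis by (simp add: simplex_set_def)
qed

end

lemma positive_solution_mass: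
  assumes "positive_solution M A astar dt V U" "dt > 0"
  shows "(\<Sum>K\<in>cells M. measure lebesgue K * U K $ i) = (\<Sum>K\<in>cells M. measure lebesgue K * V K $ i)"
  using assms step_solution_mass unfolding positive_solution_def solves_scheme_iff by blast

lemma positive_solution_exists:
  fixes V :: "'a set \<Rightarrow> real ^ 'n::finite"
  assumes dt: "dt > 0" and A: "transpose A = A" "\<And>i j. A $ i $ j \<ge> 0" "astar > 0"
    and V: "\<And>K. K \<in> cells M \<Longrightarrow> V K \<in> simplex_set"
    and mass: "\<And>i. (\<Sum>K\<in>cells M. measure lebesgue K * V K $ i) > 0"
  shows "\<exists>U. positive_solution M A astar dt V U"
proof -
  obtain U where U: "step_solution A astar dt V U" "\<And>K. K \<in> cells M \<Longrightarrow> U K \<in> simplex_set"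
    using step_solution_exists[where V = V, OF dt A V] by metis
  have "U K $ i > 0" if "K \<in> cells M" for K i
    by (rule step_solution_pos[OF U(1) dt A(2,3) U(2) V mass that])
  then show ?thesis
    unfolding positive_solution_def solves_scheme_iff using U by blast
qed

lemma positive_solution_entropy:
  assumes sol: "positive_solution M A astar dt V U" and dt: "dt > 0"
    and A: "transpose A = A" "\<And>i j. A $ i $ j \<ge> 0" "astar > 0"
    and V: "\<And>K. K \<in> cells M \<Longrightarrow> V K \<in> simplex_set"
  shows "discrete_entropy M U \<le> discrete_entropy M V"
  unfolding discrete_entropy_def
  by (rule step_solution_entropy[OF _ dt A _ V])
     (use sol in \<open>auto simp: positive_solution_def solves_scheme_iff\<close>)

end

section \<open>Induction over the time steps\<close>

theorem theorem2p2:
  fixes \<Omega> :: "(real ^ 'd) set" and M :: "(real ^ 'd) mesh"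
    and A :: "real ^ 'n ^ 'n" and astar T :: real
    and t :: "nat \<Rightarrow> real" and N\<^sub>T :: nat
    and u0 :: "real ^ 'd \<Rightarrow> real ^ 'n"
  assumes "\<Omega> \<noteq> {}" and "open \<Omega>" and "connected \<Omega>" and "bounded \<Omega>"
    and "T > 0"
    and "transpose A = A" and "\<And>i j. A $ i $ j \<ge> 0"
    and "astar > 0" and "astar \<ge> Min (range (\<lambda>(i, j). A $ i $ j))"
    and "admissible_mesh \<Omega> M"
    and "t 0 = 0" and "\<And>n. n < N\<^sub>T \<Longrightarrow> t n < t (Suc n)" and "t N\<^sub>T = T"
    and "u0 \<in> borel_measurable (lebesgue_on \<Omega>)"
    and "AE x in lebesgue_on \<Omega>. u0 x \<in> simplex_set"
    and "\<And>i. (LINT x|lebesgue_on \<Omega>. u0 x $ i) > 0"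
  shows
    "(\<forall>n\<in>{1..N\<^sub>T}. \<forall>U :: nat \<Rightarrow> (real ^ 'd) set \<Rightarrow> real ^ 'n.
        (\<forall>K\<in>cells M. U 0 K = cell_average u0 K) \<and>
        (\<forall>m\<in>{1..<n}. positive_solution M A astar (t m - t (m - 1)) (U (m - 1)) (U m))
        \<longrightarrow> (\<exists>V. positive_solution M A astar (t n - t (n - 1)) (U (n - 1)) V))
     \<and>
     (\<forall>U :: nat \<Rightarrow> (real ^ 'd) set \<Rightarrow> real ^ 'n.
        (\<forall>K\<in>cells M. U 0 K = cell_average u0 K) \<and>
        (\<forall>n\<in>{1..N\<^sub>T}. positive_solution M A astar (t n - t (n - 1)) (U (n - 1)) (U n))
        \<longrightarrow>
        (\<forall>n\<in>{1..N\<^sub>T}. discrete_entropy M (U n) \<le> discrete_entropy M (U (n - 1))) \<and>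
        (\<forall>i. \<forall>n\<in>{0..N\<^sub>T}. (\<Sum>K\<in>cells M. measure lebesgue K * U n K $ i)
                          = (LINT x|lebesgue_on \<Omega>. u0 x $ i)))"
proof -
  interpret mesh_on \<Omega> M
    by unfold_locales (fact assms)+
  note A = assms(6,7,8)
  have dt: "t n - t (n - 1) > 0" if "n \<in> {1..N\<^sub>T}" for n
    using assms(12)[of "n - 1"] that by (cases n) auto
  \<comment> \<open>Existence and entropy decay at a step both need the previous state in the
    simplex, and existence also needs its positive masses. Both facts are carried along for every
    sequence that solves the steps before \<open>n\<close>.\<close>
  have invariant: "(\<forall>K\<in>cells M. U k K \<in> simplex_set) \<and>
      (\<forall>i. (\<Sum>K\<in>cells M. measure lebesgue K * U k K $ i) = (LINT x|lebesgue_on \<Omega>. u0 x $ i))"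
    if U0: "\<forall>K\<in>cells M. U 0 K = cell_average u0 K"
      and sol: "\<forall>m\<in>{1..<n}. positive_solution M A astar (t m - t (m - 1)) (U (m - 1)) (U m)"
      and "k < n" "k \<le> N\<^sub>T"
    for U n k
    using that(3,4)
  proof (induction k)
    case 0
    then show ?case
      using U0 cell_average_simplex[OF assms(14,15)] cell_average_total_mass[OF assms(14,15)]
      by simp
  next
    case (Suc k)
    then have ps: "positive_solution M A astar (t (Suc k) - t k) (U k) (U (Suc k))"
      using sol[rule_format, of "Suc k"] by simp
    have "t (Suc k) - t k > 0" using dt[of "Suc k"] Suc.prems by simp
    from positive_solution_mass[OF ps this] show ?case
      using Suc ps by (auto simp: positive_solution_def)
  qed
  show ?thesis
  proof (intro conjI ballI allI impI; elim conjE)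
    fix n and U :: "nat \<Rightarrow> (real ^ 'd) set \<Rightarrow> real ^ 'n"
    assume n: "n \<in> {1..N\<^sub>T}" and U0: "\<forall>K\<in>cells M. U 0 K = cell_average u0 K"
      and sol: "\<forall>m\<in>{1..<n}. positive_solution M A astar (t m - t (m - 1)) (U (m - 1)) (U m)"
    have inv: "(\<forall>K\<in>cells M. U (n - 1) K \<in> simplex_set) \<and>
      (\<forall>i. (\<Sum>K\<in>cells M. measure lebesgue K * U (n - 1) K $ i) = (LINT x|lebesgue_on \<Omega>. u0 x $ i))"
      by (rule invariant[OF U0 sol]) (use n in auto)
    show "\<exists>V. positive_solution M A astar (t n - t (n - 1)) (U (n - 1)) V"
      by (rule positive_solution_exists[OF dt[OF n] A]) (use inv assms(16) in auto)
  next
    fix n and U :: "nat \<Rightarrow> (real ^ 'd) set \<Rightarrow> real ^ 'n"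
    assume n: "n \<in> {1..N\<^sub>T}" and U0: "\<forall>K\<in>cells M. U 0 K = cell_average u0 K"
      and sol: "\<forall>n\<in>{1..N\<^sub>T}. positive_solution M A astar (t n - t (n - 1)) (U (n - 1)) (U n)"
    \<comment> \<open>The half-open range up to \<open>Suc N\<^sub>T\<close> contains all the steps,
      so \<open>invariant\<close> applies to every index up to \<open>N\<^sub>T\<close>.\<close>
    have sol': "\<forall>m\<in>{1..<Suc N\<^sub>T}. positive_solution M A astar (t m - t (m - 1)) (U (m - 1)) (U m)"
      using sol by auto
    have inv: "(\<forall>K\<in>cells M. U (n - 1) K \<in> simplex_set) \<and>
      (\<forall>i. (\<Sum>K\<in>cells M. measure lebesgue K * U (n - 1) K $ i) = (LINT x|lebesgue_on \<Omega>. u0 x $ i))"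
      by (rule invariant[OF U0 sol']) (use n in auto)
    show "discrete_entropy M (U n) \<le> discrete_entropy M (U (n - 1))"
      by (rule positive_solution_entropy[OF sol[rule_format, OF n] dt[OF n] A]) (use inv in auto)
  next
    fix i n and U :: "nat \<Rightarrow> (real ^ 'd) set \<Rightarrow> real ^ 'n"
    assume n: "n \<in> {0..N\<^sub>T}" and U0: "\<forall>K\<in>cells M. U 0 K = cell_average u0 K"
      and sol: "\<forall>n\<in>{1..N\<^sub>T}. positive_solution M A astar (t n - t (n - 1)) (U (n - 1)) (U n)"
    have sol': "\<forall>m\<in>{1..<Suc N\<^sub>T}. positive_solution M A astar (t m - t (m - 1)) (U (m - 1)) (U m)"
      using sol by auto
    have "(\<forall>K\<in>cells M. U n K \<in> simplex_set) \<and>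
      (\<forall>i. (\<Sum>K\<in>cells M. measure lebesgue K * U n K $ i) = (LINT x|lebesgue_on \<Omega>. u0 x $ i))"
      by (rule invariant[OF U0 sol']) (use n in auto)
    then show "(\<Sum>K\<in>cells M. measure lebesgue K * U n K $ i) = (LINT x|lebesgue_on \<Omega>. u0 x $ i)"
      by blast
  qed
qed

end
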